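(* Let $X$ be a finite-dimensional CAT(1) space. If the radius $r=\operatorname{rad}(X)$ of $X$ is smaller than $\pi$, then the diameter of $X$ satisfies $\operatorname{diam}(X)>\operatorname{rad}(X)$.
   Context: A complete metric space is called CAT(1) if each pair of points with distance $<\pi$ is connected by a geodesic and all geodesic triangles of perimeter less than $2\pi$ are not thicker than their comparison triangles in the unit sphere $S^2$. For a metric space $X$ and $x\in X$ put $\operatorname{rad}_x(X)=\sup_{z\in X}d(x,z)$, $\operatorname{rad}(X)=\inf_{x\in X}\operatorname{rad}_x(X)$ and $\operatorname{diam}(X)=\sup_{x\in X}\operatorname{rad}_x(X)$. The dimension is the geometric dimension in the sense of Kleiner: the supremum of the topological (covering) dimensions of compact subsets of $X$.
   Formalization: The space X is additionally assumed not to be a single point, since a one-point space is a 0-dimensional CAT(1) space with rad(X) = diam(X) = 0 < π, for which the claim fails. *)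

theory Defs
  imports "HOL-Analysis.Analysis"
begin

subsection \<open>Geodesics and CAT(1) spaces\<close>

text \<open>
  Geodesics are parametrised by arc length. The distance function is a parameter because the
  definition is used both for metric spaces of the class \<^class>\<open>metric_space\<close> and for the unit
  sphere with its angular metric (rather than the chordal one induced by \<^const>\<open>dist\<close>).
\<close>

definition geodesic :: "'a set \<Rightarrow> ('a \<Rightarrow> 'a \<Rightarrow> real) \<Rightarrow> 'a \<Rightarrow> 'a \<Rightarrow> (real \<Rightarrow> 'a) \<Rightarrow> bool"
  where "geodesic M d x y \<gamma> \<longleftrightarrow>
    x \<in> M \<and> y \<in> M \<and> \<gamma> ` {0..d x y} \<subseteq> M \<and> \<gamma> 0 = x \<and> \<gamma> (d x y) = y \<and>
    (\<forall>s\<in>{0..d x y}. \<forall>t\<in>{0..d x y}. d (\<gamma> s) (\<gamma> t) = \<bar>s - t\<bar>)"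

definition S2 :: "(real^3) set"
  where "S2 = sphere 0 1"

definition S2_dist :: "real^3 \<Rightarrow> real^3 \<Rightarrow> real"
  where "S2_dist u v = arccos (u \<bullet> v)"

text \<open>
  The vertices are \<open>v 0\<close>, \<open>v 1\<close>, \<open>v 2\<close>, and side \<open>\<gamma> i\<close> runs from \<open>v i\<close> to the cyclically
  next vertex.
\<close>

definition geodesic_triangle ::
    "'a set \<Rightarrow> ('a \<Rightarrow> 'a \<Rightarrow> real) \<Rightarrow> (nat \<Rightarrow> 'a) \<Rightarrow> (nat \<Rightarrow> real \<Rightarrow> 'a) \<Rightarrow> bool"
  where "geodesic_triangle M d v \<gamma> \<longleftrightarrow>
    (\<forall>i<3. geodesic M d (v i) (v (Suc i mod 3)) (\<gamma> i))"

definition perimeter :: "('a \<Rightarrow> 'a \<Rightarrow> real) \<Rightarrow> (nat \<Rightarrow> 'a) \<Rightarrow> real"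
  where "perimeter d v = (\<Sum>i<3. d (v i) (v (Suc i mod 3)))"

definition comparison_triangle ::
    "(nat \<Rightarrow> 'a::metric_space) \<Rightarrow> (nat \<Rightarrow> real^3) \<Rightarrow> (nat \<Rightarrow> real \<Rightarrow> real^3) \<Rightarrow> bool"
  where "comparison_triangle v w c \<longleftrightarrow>
    geodesic_triangle S2 S2_dist w c \<and>
    (\<forall>i<3. S2_dist (w i) (w (Suc i mod 3)) = dist (v i) (v (Suc i mod 3)))"

text \<open>
  A triangle of perimeter less than \<open>2 * pi\<close> has a comparison triangle, unique up to an isometry
  of the sphere, so quantifying existentially over it below is no different from quantifying
  universally.
\<close>

definition CAT1 :: "'a::metric_space set \<Rightarrow> bool"
  where "CAT1 X \<longleftrightarrow>
    complete X \<and>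
    (\<forall>x\<in>X. \<forall>y\<in>X. dist x y < pi \<longrightarrow> (\<exists>\<gamma>. geodesic X dist x y \<gamma>)) \<and>
    (\<forall>v \<gamma>. geodesic_triangle X dist v \<gamma> \<and> perimeter dist v < 2 * pi \<longrightarrow>
      (\<exists>w c. comparison_triangle v w c \<and>
        (\<forall>i<3. \<forall>j<3.
          \<forall>s\<in>{0..dist (v i) (v (Suc i mod 3))}. \<forall>t\<in>{0..dist (v j) (v (Suc j mod 3))}.
            dist (\<gamma> i s) (\<gamma> j t) \<le> S2_dist (c i s) (c j t))))"

subsection \<open>Radius and diameter\<close>

text \<open>Values are extended reals so that unbounded spaces have infinite radius and diameter.\<close>

definition rad_at :: "'a::metric_space set \<Rightarrow> 'a \<Rightarrow> ereal"
  where "rad_at X x = (SUP z\<in>X. ereal (dist x z))"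

definition rad :: "'a::metric_space set \<Rightarrow> ereal"
  where "rad X = (INF x\<in>X. rad_at X x)"

definition diam :: "'a::metric_space set \<Rightarrow> ereal"
  where "diam X = (SUP x\<in>X. rad_at X x)"

subsection \<open>Dimension\<close>

text \<open>Every open cover has an open refinement with each point in at most \<open>n\<close> of its members.\<close>

definition refinable_to_ply :: "'a topology \<Rightarrow> nat \<Rightarrow> bool"
  where "refinable_to_ply T n \<longleftrightarrow>
    (\<forall>\<U>. (\<forall>U\<in>\<U>. openin T U) \<and> \<Union>\<U> = topspace T \<longrightarrow>
      (\<exists>\<V>. (\<forall>V\<in>\<V>. openin T V) \<and> \<Union>\<V> = topspace T \<and>
        (\<forall>V\<in>\<V>. \<exists>U\<in>\<U>. V \<subseteq> U) \<and>
        (\<forall>x\<in>topspace T. finite {V \<in> \<V>. x \<in> V} \<and> card {V \<in> \<V>. x \<in> V} \<le> n)))"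

text \<open>The least \<open>m \<ge> -1\<close> with ply \<open>m + 1\<close>; it is \<open>-1\<close> for the empty space and \<open>\<infinity>\<close> if no
  such \<open>m\<close> exists.\<close>

definition covering_dim :: "'a topology \<Rightarrow> ereal"
  where "covering_dim T = (INF n\<in>{n. refinable_to_ply T n}. ereal (real n - 1))"

definition geometric_dim :: "'a::metric_space set \<Rightarrow> ereal"
  where "geometric_dim X = (SUP K\<in>{K. compact K \<and> K \<subseteq> X}. covering_dim (top_of_set K))"

end

theory Submission imports Defs
begin

text \<open>
  Suppose \<open>diam X = rad X = r < pi\<close>. For every \<open>x\<close> there is \<open>z\<close> with \<open>dist x z\<close> almost \<open>r\<close>, while
  all of \<open>X\<close> is within \<open>r\<close> of \<open>z\<close>. Moving every point a small distance \<open>\<delta>\<close> towards \<open>z\<close> along the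
  unique geodesic is therefore an arbitrarily small homotopy of \<open>X\<close> that pushes \<open>X\<close> off a ball
  around \<open>x\<close>.

  This is impossible in finite dimension. Let \<open>S\<close> be the \<open>n\<close>-sphere, up to homotopy, and consider the
  property \<open>E m\<close> that maps from closed subsets of compact sets \<open>K \<subseteq> X\<close> into the \<open>m\<close>-fold loop
  space of \<open>S\<close> extend to \<open>K\<close>. If the compact subsets of \<open>X\<close> have dimension at most \<open>n\<close>, then
  \<open>E 0\<close> holds. Moreover \<open>E m\<close> implies \<open>E (Suc m)\<close>: on a small ball, a map into the
  \<open>(m + 1)\<close>-fold loop space given outside the ball leaves as obstruction a map into the \<open>m\<close>-fold loop
  space that is trivial off the ball; \<open>E m\<close> extends it over \<open>X\<close>, and pushing \<open>X\<close> off the ball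
  contracts it. But \<open>E n\<close> fails, because a path in \<open>X\<close> joins two distinct points and the
  \<open>n\<close>-fold loop space of \<open>S\<close> is not connected, by Brouwer's theorem.
\<close>

subsection \<open>Extension of maps and homotopies\<close>

text \<open>Continuity into the product topology is coordinatewise, so the real-valued Tietze
  theorem applies to each coordinate separately.\<close>

lemma Tietze_fun:
  fixes Z :: "'z::metric_space set" and f :: "'z \<Rightarrow> nat \<Rightarrow> real"
  assumes "closed D" "D \<subseteq> Z" "continuous_on D f"
  obtains g where "continuous_on Z g" "\<And>z. z \<in> D \<Longrightarrow> g z = f z"
proof -
  have "\<exists>g. continuous_on Z g \<and> (\<forall>z\<in>D. g z = f z i)" for i
  proof -
    have "normal_space (top_of_set Z)"
      by (simp add: metrizable_imp_normal_space metrizable_space_euclidean metrizable_space_subtopology)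
    moreover have "closedin (top_of_set Z) D"
      using assms by (simp add: closed_subset)
    moreover have "continuous_map (subtopology (top_of_set Z) D) euclidean (\<lambda>z. f z i)"
      using assms(2) continuous_on_product_then_coordinatewise[OF assms(3)]
      by (simp add: subtopology_subtopology Int_absorb1)
    ultimately show ?thesis
      using normal_space_iff_Tietze[of "top_of_set Z"] by (metis continuous_map_iff_continuous)
  qed
  then obtain g where g: "\<And>i. continuous_on Z (g i)" "\<And>i z. z \<in> D \<Longrightarrow> g i z = f z i"
    by metis
  show thesis
  proof
    show "continuous_on Z (\<lambda>z i. g i z)"
      by (intro continuous_on_coordinatewise_then_product g)
  qed (use g in auto)
qed

lemma Urysohn_metric:
  fixes Z :: "'z::metric_space set"
  assumes "closed S" "closed T" "S \<inter> T = {}"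
  obtains u :: "'z \<Rightarrow> real" where "continuous_on UNIV u" "\<And>z. u z \<in> {0..1}"
    "\<And>z. z \<in> S \<Longrightarrow> u z = 0" "\<And>z. z \<in> T \<Longrightarrow> u z = 1"
proof -
  have "normal_space (euclidean :: 'z topology)"
    by (simp add: metrizable_imp_normal_space metrizable_space_euclidean)
  then obtain u :: "'z \<Rightarrow> real" where "continuous_map euclidean (top_of_set {0..1}) u"
      "u ` S \<subseteq> {0}" "u ` T \<subseteq> {1}"
    using Urysohn_lemma[of "euclidean :: 'z topology" S T 0 1] assms by (auto simp: disjnt_def)
  then show thesis
    by (intro that[of u]) (auto simp: continuous_map_in_subtopology)
qed

text \<open>Borsuk's argument: a Tietze extension of the data may leave the open set
  \<open>V\<close>, but only over a closed set of base points away from \<open>D\<close>. Slowing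
  time down to \<open>0\<close> there keeps the homotopy inside \<open>V\<close>.\<close>

lemma homotopy_extension:
  fixes Z :: "'z::metric_space set" and h :: "'z \<times> real \<Rightarrow> nat \<Rightarrow> real"
  assumes "compact Z" "closed D" "D \<subseteq> Z" "open V"
    and h: "continuous_on (D \<times> {0..1}) h" "h ` (D \<times> {0..1}) \<subseteq> V"
    and k: "continuous_on Z k" "k ` Z \<subseteq> V"
    and hk: "\<And>z. z \<in> D \<Longrightarrow> h (z, 0) = k z"
  obtains H where "continuous_on (Z \<times> {0..1}) H" "H ` (Z \<times> {0..1}) \<subseteq> V"
    "\<And>z. z \<in> Z \<Longrightarrow> H (z, 0) = k z"
    "\<And>z t. z \<in> D \<Longrightarrow> t \<in> {0..1} \<Longrightarrow> H (z, t) = h (z, t)"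
proof -
  have cZ: "closed Z" using assms compact_imp_closed by blast
  define f where "f = (\<lambda>p::'z \<times> real. if p \<in> Z \<times> {0} then k (fst p) else h p)"
  have "continuous_on (Z \<times> {0} \<union> D \<times> {0..1}) f"
    unfolding f_def
  proof (rule continuous_on_cases)
    show "continuous_on (Z \<times> {0::real}) (\<lambda>p. k (fst p))"
      by (rule continuous_on_compose2[OF k(1)]) (auto intro!: continuous_intros)
  qed (use cZ assms hk in \<open>auto intro!: closed_Times\<close>)
  moreover have "closed (Z \<times> {0::real} \<union> D \<times> {0..1::real})"
    using cZ assms by (intro closed_Un closed_Times) auto
  moreover have "Z \<times> {0::real} \<union> D \<times> {0..1} \<subseteq> Z \<times> {0..1}"
    using assms(3) by auto
  ultimately obtain G where G: "continuous_on (Z \<times> {0..1}) G"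
    "\<And>p. p \<in> Z \<times> {0} \<union> D \<times> {0..1} \<Longrightarrow> G p = f p"
    using Tietze_fun[of "Z \<times> {0::real} \<union> D \<times> {0..1}" "Z \<times> {0..1}" f] by metis
  \<comment> \<open>The points over which \<open>G\<close> leaves \<open>V\<close> at some time. As
    the projection of a compact set it is closed, so a Urysohn function separates it from
    \<open>D\<close>.\<close>
  define B where "B = fst ` ((Z \<times> {0..1}) \<inter> G -` (- V))"
  have "closedin (top_of_set (Z \<times> {0..1::real})) ((Z \<times> {0..1}) \<inter> G -` (- V))"
    using G(1) assms(4) by (intro continuous_closedin_preimage) auto
  then have "compact ((Z \<times> {0..1::real}) \<inter> G -` (- V))"
    by (rule closedin_compact[rotated]) (simp add: assms(1) compact_Times)
  then have "closed B"
    unfolding B_def by (intro compact_imp_closed compact_continuous_image continuous_intros)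
  moreover have "B \<inter> D = {}"
  proof -
    have "G (z, t) \<in> V" if "z \<in> D" "t \<in> {0..1}" for z t
      using G(2)[of "(z,t)"] that h(2) k(2) hk[of z] by (auto simp: f_def)
    then show ?thesis by (auto simp: B_def)
  qed
  ultimately obtain u :: "'z \<Rightarrow> real" where u: "continuous_on UNIV u" "\<And>z. u z \<in> {0..1}"
    "\<And>z. z \<in> B \<Longrightarrow> u z = 0" "\<And>z. z \<in> D \<Longrightarrow> u z = 1"
    using Urysohn_metric[of B D] assms by metis
  have cu: "continuous_on S (\<lambda>p. u (fst p))" for S :: "('z \<times> real) set"
    by (rule continuous_on_compose2[OF u(1)]) (auto intro!: continuous_intros)
  have ran: "t * u z \<in> {0..1}" if "t \<in> {0..1}" for t z
    using u(2)[of z] that by (auto intro: mult_le_one)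
  show thesis
  proof
    show "continuous_on (Z \<times> {0..1}) (\<lambda>p. G (fst p, snd p * u (fst p)))"
      by (rule continuous_on_compose2[OF G(1)]) (auto intro!: continuous_intros cu ran[simplified])
    have "G (z, t * u z) \<in> V" if "z \<in> Z" "t \<in> {0..1}" for z t
    proof (cases "z \<in> B")
      case True
      then have "G (z, t * u z) = k z" using G(2)[of "(z,0)"] u(3) that by (auto simp: f_def)
      then show ?thesis using k that by auto
    next
      case False
      show ?thesis
      proof (rule ccontr)
        assume "G (z, t * u z) \<notin> V"
        then have "(z, t * u z) \<in> (Z \<times> {0..1}) \<inter> G -` (- V)" using ran[OF that(2), of z] that(1) by auto
        then show False using False unfolding B_def by (metis fst_conv imageI)
      qed
    qed
    then show "(\<lambda>p. G (fst p, snd p * u (fst p))) ` (Z \<times> {0..1}) \<subseteq> V" by auto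
    show "G (fst (z, 0), snd (z, 0) * u (fst (z, 0))) = k z" if "z \<in> Z" for z
      using G(2)[of "(z,0)"] that by (auto simp: f_def)
    show "G (fst (z, t), snd (z, t) * u (fst (z, t))) = h (z, t)" if "z \<in> D" "t \<in> {0..1}" for z t
      using G(2)[of "(z,t)"] that u(4) hk[of z] assms(3) by (auto simp: f_def)
  qed
qed

text \<open>Extendability from \<open>D\<close> depends only on the homotopy class: evaluate the
  extended homotopy at time \<open>1\<close>. This turns a map that is right on \<open>D\<close> up
  to homotopy into one with the prescribed values there.\<close>

lemma homotopic_extendable:
  fixes Z :: "'z::metric_space set" and h :: "'z \<times> real \<Rightarrow> nat \<Rightarrow> real"
  assumes "compact Z" "closed D" "D \<subseteq> Z" "open V"
    and "continuous_on (D \<times> {0..1}) h" "h ` (D \<times> {0..1}) \<subseteq> V"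
    and "continuous_on Z k" "k ` Z \<subseteq> V"
    and "\<And>z. z \<in> D \<Longrightarrow> h (z, 0) = k z"
  obtains g where "continuous_on Z g" "g ` Z \<subseteq> V" "\<And>z. z \<in> D \<Longrightarrow> g z = h (z, 1)"
proof -
  obtain H where H: "continuous_on (Z \<times> {0..1}) H" "H ` (Z \<times> {0..1}) \<subseteq> V"
    "\<And>z t. z \<in> D \<Longrightarrow> t \<in> {0..1} \<Longrightarrow> H (z, t) = h (z, t)"
    using homotopy_extension[OF assms] by metis
  show thesis
  proof
    show "continuous_on Z (\<lambda>z. H (z, 1))"
      by (rule continuous_on_compose2[OF H(1)]) (auto intro!: continuous_intros)
  qed (use H in auto)
qed

subsection \<open>Covering dimension and extension of maps to a sphere\<close>

text \<open>The coordinates beyond \<open>n\<close> are irrelevant, so this is \<open>\<real>\<^sup>n\<^sup>+\<^sup>1\<close> without the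
  origin: a model of the \<open>n\<close>-sphere whose dimension is a term rather than a type.\<close>

definition punctured :: "nat \<Rightarrow> (nat \<Rightarrow> real) set"
  where "punctured n = {v. \<exists>i\<le>n. v i \<noteq> 0}"

lemma open_punctured: "open (punctured n)"
proof -
  have "open ((\<lambda>v::nat \<Rightarrow> real. v i) -` (- {0}))" for i
    by (intro open_vimage continuous_on_product_coordinates) auto
  moreover have "punctured n = (\<Union>i\<le>n. (\<lambda>v. v i) -` (- {0}))"
    by (auto simp: punctured_def)
  ultimately show ?thesis by auto
qed

text \<open>Each member of a refinement of ply \<open>N\<close> is assigned to one of the
  \<open>N + 1\<close> given sets that contains it. A point common to all \<open>W i\<close> would
  lie in \<open>N + 1\<close> members, distinct because their assignments differ.\<close>

lemma refinable_shrink: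
  fixes U :: "nat \<Rightarrow> 'a::metric_space set"
  assumes "refinable_to_ply (top_of_set K) N"
    and "\<And>i. i \<le> N \<Longrightarrow> openin (top_of_set K) (U i)" "(\<Union>i\<le>N. U i) = K"
  obtains W where "\<And>i. i \<le> N \<Longrightarrow> openin (top_of_set K) (W i)" "\<And>i. i \<le> N \<Longrightarrow> W i \<subseteq> U i"
    "(\<Union>i\<le>N. W i) = K" "(\<Inter>i\<le>N. W i) = {}"
proof -
  obtain \<V> where \<V>: "\<And>V. V \<in> \<V> \<Longrightarrow> openin (top_of_set K) V" "\<Union>\<V> = K"
    "\<And>V. V \<in> \<V> \<Longrightarrow> \<exists>S\<in>U ` {..N}. V \<subseteq> S"
    "\<And>x. x \<in> K \<Longrightarrow> finite {V \<in> \<V>. x \<in> V} \<and> card {V \<in> \<V>. x \<in> V} \<le> N"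
  proof -
    let ?\<U> = "U ` {..N}"
    have "(\<forall>S\<in>?\<U>. openin (top_of_set K) S) \<and> \<Union>?\<U> = topspace (top_of_set K)"
      using assms(2,3) by simp
    then have "\<exists>\<V>. (\<forall>V\<in>\<V>. openin (top_of_set K) V) \<and> \<Union>\<V> = topspace (top_of_set K) \<and>
        (\<forall>V\<in>\<V>. \<exists>S\<in>?\<U>. V \<subseteq> S) \<and>
        (\<forall>x\<in>topspace (top_of_set K). finite {V \<in> \<V>. x \<in> V} \<and> card {V \<in> \<V>. x \<in> V} \<le> N)"
      by (rule assms(1)[unfolded refinable_to_ply_def, THEN spec, THEN mp])
    then obtain \<V> where "(\<forall>V\<in>\<V>. openin (top_of_set K) V) \<and> \<Union>\<V> = K \<and>
        (\<forall>V\<in>\<V>. \<exists>S\<in>?\<U>. V \<subseteq> S) \<and>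
        (\<forall>x\<in>K. finite {V \<in> \<V>. x \<in> V} \<and> card {V \<in> \<V>. x \<in> V} \<le> N)"
      unfolding topspace_euclidean_subtopology by (elim exE)
    then show thesis by (intro that[of \<V>]) simp_all
  qed
  obtain a where a: "\<And>V. V \<in> \<V> \<Longrightarrow> a V \<le> N \<and> V \<subseteq> U (a V)"
  proof -
    have "\<exists>i. i \<le> N \<and> V \<subseteq> U i" if "V \<in> \<V>" for V using \<V>(3)[OF that] by auto
    then show thesis using that by metis
  qed
  define W where "W = (\<lambda>i. \<Union>{V \<in> \<V>. a V = i})"
  show thesis
  proof
    show "openin (top_of_set K) (W i)" for i
      unfolding W_def using \<V>(1) by (intro openin_Union) auto
    show "W i \<subseteq> U i" for i using a by (auto simp: W_def)
    show "(\<Union>i\<le>N. W i) = K" unfolding \<V>(2)[symmetric] using a by (auto simp: W_def)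
    show "(\<Inter>i\<le>N. W i) = {}"
    proof (rule ccontr)
      assume "(\<Inter>i\<le>N. W i) \<noteq> {}"
      then obtain y where y: "\<And>i. i \<le> N \<Longrightarrow> y \<in> W i" by auto
      then have "\<exists>V. V \<in> \<V> \<and> a V = i \<and> y \<in> V" if "i \<le> N" for i
        using that unfolding W_def by blast
      then obtain v where v: "\<And>i. i \<le> N \<Longrightarrow> v i \<in> \<V> \<and> a (v i) = i \<and> y \<in> v i" by metis
      have "inj_on v {..N}" using v by (metis atMost_iff inj_onI)
      then have "card (v ` {..N}) = Suc N" by (simp add: card_image)
      moreover have "y \<in> K" using v[of 0] \<V>(2) by auto
      moreover have "v ` {..N} \<subseteq> {V \<in> \<V>. y \<in> V}" using v by auto
      ultimately have "Suc N \<le> N" using \<V>(4)[of y] card_mono[of "{V \<in> \<V>. y \<in> V}" "v ` {..N}"] by simp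
      then show False by simp
    qed
  qed
qed

lemma zero_sum_last:
  fixes a :: "nat \<Rightarrow> real"
  assumes "(\<Sum>i\<le>Suc n. a i) = 0" "\<And>i. i \<le> n \<Longrightarrow> a i = 0" "i \<le> Suc n"
  shows "a i = 0"
  using assms by (cases "i = Suc n") auto

text \<open>Each entry is minus the sum of the other \<open>n + 1\<close>, all of which exceed
  \<open>- e\<close>.\<close>

lemma zero_sum_bound:
  fixes F :: "nat \<Rightarrow> real"
  assumes "(\<Sum>i\<le>Suc n. F i) = 0" "\<And>i. i \<le> Suc n \<Longrightarrow> F i > - e" "i \<le> Suc n"
  shows "\<bar>F i\<bar> \<le> (real n + 1) * e"
proof -
  have "F i = - (\<Sum>j\<in>{..Suc n} - {i}. F j)"
    using assms(1,3) sum.remove[of "{..Suc n}" i F] by simp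
  also have "\<dots> = (\<Sum>j\<in>{..Suc n} - {i}. - F j)" by (simp add: sum_negf)
  also have "\<dots> \<le> (\<Sum>j\<in>{..Suc n} - {i}. e)"
    using assms(2) by (intro sum_mono) (smt (verit) DiffE atMost_iff)
  also have "\<dots> = (real n + 1) * e" using assms(3) by simp
  finally have "F i \<le> (real n + 1) * e" .
  moreover have "e \<ge> 0"
  proof (rule ccontr)
    assume "\<not> e \<ge> 0"
    then have "(\<Sum>i\<le>Suc n. F i) > 0" using assms(2) by (intro sum_pos) (auto, smt (verit))
    then show False using assms(1) by simp
  qed
  then have "e \<le> (real n + 1) * e" by (simp add: algebra_simps)
  ultimately show ?thesis using assms(2,3) by (smt (verit))
qed

text \<open>Write \<open>f\<close> as \<open>n + 2\<close> functions of sum zero, the last one being minus the sum of the others.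
  The sets where these exceed \<open>-e\<close> have a shrinking with empty intersection, whose distance
  functions are never all equal; recentred, they are homotopic to \<open>f\<close> on \<open>K0\<close>.\<close>

lemma extend_to_punctured:
  fixes K :: "'a::metric_space set" and f :: "'a \<Rightarrow> nat \<Rightarrow> real"
  assumes K: "compact K" "refinable_to_ply (top_of_set K) (Suc n)"
    and K0: "closed K0" "K0 \<subseteq> K"
    and f: "continuous_on K0 f" "f ` K0 \<subseteq> punctured n"
  obtains g where "continuous_on K g" "g ` K \<subseteq> punctured n" "\<And>x. x \<in> K0 \<Longrightarrow> g x = f x"
proof -
  obtain G where G: "continuous_on K G" "\<And>x. x \<in> K0 \<Longrightarrow> G x = f x"
    using Tietze_fun[OF K0 f(1)] by metis
  define F where "F = (\<lambda>y i. if i \<le> n then G y i else - (\<Sum>j\<le>n. G y j))"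
  have contG: "continuous_on K (\<lambda>y. G y i)" for i
    using continuous_on_product_then_coordinatewise[OF G(1)] .
  have contF: "continuous_on K (\<lambda>y. F y i)" for i
    unfolding F_def by (cases "i \<le> n") (auto intro!: continuous_intros contG)
  have sumF: "(\<Sum>i\<le>Suc n. F y i) = 0" for y
    by (simp add: F_def)
  \<comment> \<open>A positive minimum over the compact set \<open>K0\<close>, where
    \<open>f\<close> has a nonzero coordinate of index at most \<open>n\<close>; any positive
    constant serves if \<open>K0\<close> is empty.\<close>
  obtain c where c: "c > 0" "\<And>y. y \<in> K0 \<Longrightarrow> c \<le> (\<Sum>i\<le>n. \<bar>F y i\<bar>)"
  proof (cases "K0 = {}")
    case False
    have "compact K0" using K(1) K0 by (metis compact_Int_closed inf.absorb_iff2)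
    moreover have "continuous_on K0 (\<lambda>y. \<Sum>i\<le>n. \<bar>F y i\<bar>)"
      using contF K0 by (intro continuous_intros) (blast intro: continuous_on_subset)
    ultimately obtain y0 where y0: "y0 \<in> K0" "\<And>y. y \<in> K0 \<Longrightarrow> (\<Sum>i\<le>n. \<bar>F y0 i\<bar>) \<le> (\<Sum>i\<le>n. \<bar>F y i\<bar>)"
      using continuous_attains_inf[of K0 "\<lambda>y. \<Sum>i\<le>n. \<bar>F y i\<bar>"] False by auto
    obtain i where i: "i \<le> n" "F y0 i \<noteq> 0"
      using f(2) y0(1) G(2)[OF y0(1)] by (fastforce simp: punctured_def F_def)
    then have "(\<Sum>i\<le>n. \<bar>F y0 i\<bar>) > 0" by (intro sum_pos2[of _ i]) auto
    then show thesis using that y0(2) by blast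
  qed (use that[of 1] in auto)
  \<comment> \<open>With this value, if all entries of \<open>F y\<close> exceed \<open>- e\<close>,
    then \<open>\<Sum>i\<le>n. \<bar>F y i\<bar>\<close> is at most \<open>c / 2\<close>, which is
    impossible on \<open>K0\<close>.\<close>
  define e where "e = c / (2 * (real n + 1)\<^sup>2)"
  have e: "e > 0" using c by (simp add: e_def)
  define U where "U = (\<lambda>i. {y \<in> K. F y i > - e})"
  have "openin (top_of_set K) (U i)" for i
  proof -
    have "U i = K \<inter> (\<lambda>y. F y i) -` {- e<..}" by (auto simp: U_def)
    then show ?thesis using continuous_openin_preimage_gen[OF contF] by simp
  qed
  moreover have "(\<Union>i\<le>Suc n. U i) = K"
  proof -
    have "\<exists>i\<le>Suc n. F y i > - e" for y
    proof (rule ccontr)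
      assume "\<not> (\<exists>i\<le>Suc n. F y i > - e)"
      then have "- F y i > 0" if "i \<le> Suc n" for i using e that by (smt (verit))
      then have "(\<Sum>i\<le>Suc n. - F y i) > 0" by (intro sum_pos) auto
      then show False using sumF[of y] by (simp add: sum_negf del: sum.atMost_Suc)
    qed
    then show ?thesis by (auto simp: U_def)
  qed
  ultimately obtain W where W: "\<And>i. i \<le> Suc n \<Longrightarrow> openin (top_of_set K) (W i)"
    "\<And>i. i \<le> Suc n \<Longrightarrow> W i \<subseteq> U i" "(\<Union>i\<le>Suc n. W i) = K" "(\<Inter>i\<le>Suc n. W i) = {}"
    using refinable_shrink[OF K(2), of U] by metis
  \<comment> \<open>\<open>infdist\<close> to the empty set is \<open>0\<close>, so the case
    \<open>W i = K\<close> gets the value \<open>1\<close> instead; thus \<open>l y i\<close> is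
    positive exactly for \<open>y\<close> in \<open>W i\<close>.\<close>
  define l where "l = (\<lambda>y i. if W i = K then 1 else infdist y (K - W i))"
  have contl: "continuous_on K (\<lambda>y. l y i)" for i
    unfolding l_def by (cases "W i = K") (auto intro!: continuous_intros)
  have l0: "l y i \<ge> 0" for y i by (simp add: l_def infdist_nonneg)
  have lpos: "l y i > 0 \<longleftrightarrow> y \<in> W i" if "y \<in> K" "i \<le> Suc n" for y i
  proof (cases "W i = K")
    case False
    have "W i \<subseteq> K" using W(1)[OF that(2)] by (simp add: openin_imp_subset)
    have "closedin (top_of_set K) (K - W i)"
      using W(1)[OF that(2)] by (auto intro: closedin_diff)
    then have "closed (K - W i)"
      using K(1) closedin_compact compact_imp_closed by blast
    moreover have "K - W i \<noteq> {}" using False \<open>W i \<subseteq> K\<close> by auto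
    ultimately have "infdist y (K - W i) = 0 \<longleftrightarrow> y \<in> K - W i"
      using in_closed_iff_infdist_zero by metis
    then show ?thesis using False that infdist_nonneg[of y "K - W i"] by (auto simp: l_def less_le)
  qed (use that in \<open>simp add: l_def\<close>)
  define M where "M = (\<lambda>y. (\<Sum>i\<le>Suc n. l y i) / (real n + 2))"
  have contM: "continuous_on K M"
    unfolding M_def by (intro continuous_intros contl) auto
  have suml: "(\<Sum>i\<le>Suc n. l y i - M y) = 0" for y
  proof -
    have "(\<Sum>i\<le>Suc n. l y i - M y) = (\<Sum>i\<le>Suc n. l y i) - (real n + 2) * M y"
      by (simp add: sum_subtractf algebra_simps del: sum.atMost_Suc)
    then show ?thesis by (simp add: M_def del: sum.atMost_Suc)
  qed
  have M0: "M y \<ge> 0" for y unfolding M_def using l0 by (intro divide_nonneg_pos sum_nonneg) auto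
  \<comment> \<open>The straight line from the recentred distance functions at \<open>t = 0\<close>
    to \<open>F\<close> at \<open>t = 1\<close>. It avoids the origin for all \<open>t\<close> over
    \<open>K0\<close>, and at \<open>t = 0\<close> over all of \<open>K\<close>.\<close>
  define h where "h = (\<lambda>(y, t) i. t * F y i + (1 - t) * (l y i - M y))"
  have nz: "h (y, t) \<in> punctured n" if y: "y \<in> K" and t: "0 \<le> t" "t \<le> 1" "y \<in> K0 \<or> t = 0" for y t
  proof (rule ccontr)
    assume "h (y, t) \<notin> punctured n"
    then have "h (y, t) i = 0" if "i \<le> n" for i using that by (auto simp: punctured_def)
    moreover have "(\<Sum>i\<le>Suc n. h (y, t) i) = 0"
      by (simp only: h_def prod.case sum.distrib sum_distrib_left[symmetric] sumF suml mult_zero_right add_0)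
    ultimately have h0: "t * F y i = (1 - t) * (M y - l y i)" if "i \<le> Suc n" for i
      using zero_sum_last[of "h (y, t)" n i] that by (auto simp: h_def algebra_simps)
    show False
    proof (cases "t = 0")
      case True
      \<comment> \<open>The sets \<open>W i\<close> cover \<open>K\<close> without a common point,
        so one distance function is positive and another vanishes; they cannot all equal their
        mean.\<close>
      obtain i j where ij: "i \<le> Suc n" "y \<in> W i" "j \<le> Suc n" "y \<notin> W j"
        using W(3,4) y by blast
      then have "l y i > 0" "l y j = 0"
        using lpos[OF y, of i] lpos[OF y, of j] l0[of y j] by (auto simp: less_le)
      then show False using h0[of i] h0[of j] ij True by simp
    next
      case False
      then have "y \<in> K0" using t by auto
      show False
      \<comment> \<open>An entry at most \<open>- e\<close> puts \<open>y\<close> outside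
        \<open>W i\<close>, and \<open>h0\<close> then equates a negative number with a nonnegative
        one. If there is no such entry, the choice of \<open>e\<close> gives the
        contradiction.\<close>
      proof (cases "\<exists>i\<le>Suc n. F y i \<le> - e")
        case True
        then obtain i where i: "i \<le> Suc n" "F y i \<le> - e" by auto
        then have "y \<notin> W i" using W(2)[OF i(1)] by (auto simp: U_def)
        then have "l y i = 0" using lpos[OF y i(1)] l0[of y i] by auto
        then have "t * F y i \<ge> 0" using h0[OF i(1)] M0[of y] t by simp
        moreover have "t * F y i < 0" using False t i e by (intro mult_pos_neg) auto
        ultimately show False by simp
      next
        case False
        then have "F y i > - e" if "i \<le> Suc n" for i using that by (meson not_le)
        then have "\<bar>F y i\<bar> \<le> (real n + 1) * e" if "i \<le> Suc n" for i
          using zero_sum_bound[OF sumF[of y], of e i] that by blast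
        then have "(\<Sum>i\<le>n. \<bar>F y i\<bar>) \<le> (\<Sum>i\<le>n. (real n + 1) * e)" by (intro sum_mono) auto
        also have "\<dots> = (real n + 1)\<^sup>2 * e" by (simp add: power2_eq_square algebra_simps)
        also have "\<dots> = c / 2" by (simp add: e_def field_simps)
        finally show False using c(1) c(2)[OF \<open>y \<in> K0\<close>] by simp
      qed
    qed
  qed
  have conth: "continuous_on (K0 \<times> {0..1}) h"
    unfolding h_def case_prod_unfold
    using K0(2)
    by (intro continuous_on_coordinatewise_then_product continuous_intros
        continuous_on_compose2[OF contF] continuous_on_compose2[OF contl]
        continuous_on_compose2[OF contM]) auto
  have contk: "continuous_on K (\<lambda>y. h (y, 0))"
    unfolding h_def case_prod_unfold
    by (intro continuous_on_coordinatewise_then_product continuous_intros)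
      (auto intro!: continuous_intros contF contl contM)
  \<comment> \<open>Coordinates beyond \<open>n\<close> do not affect membership in
    \<open>punctured n\<close>, but those of \<open>h\<close> need not be those of \<open>f\<close>
    at time \<open>1\<close>. Restoring them makes the final extension agree with \<open>f\<close>
    exactly.\<close>
  define v where "v = (\<lambda>p::'a \<times> real. (\<lambda>i. if i \<le> n then h p i else f (fst p) i))"
  have contv: "continuous_on (K0 \<times> {0..1}) v"
    unfolding v_def
  proof (rule continuous_on_coordinatewise_then_product)
    fix i
    show "continuous_on (K0 \<times> {0..1}) (\<lambda>p. if i \<le> n then h p i else f (fst p) i)"
      by (cases "i \<le> n")
        (auto intro!: continuous_on_product_then_coordinatewise[OF conth]
           continuous_on_compose2[OF continuous_on_product_then_coordinatewise[OF f(1)]]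
           continuous_intros)
  qed
  have punct_cong: "v' \<in> punctured n \<longleftrightarrow> w \<in> punctured n" if "\<And>i. i \<le> n \<Longrightarrow> v' i = w i" for v' w
    using that by (auto simp: punctured_def)
  define k where "k = (\<lambda>y i. if i \<le> n then h (y, 0) i else G y i)"
  have contk': "continuous_on K k"
    unfolding k_def
  proof (rule continuous_on_coordinatewise_then_product)
    fix i
    show "continuous_on K (\<lambda>y. if i \<le> n then h (y, 0) i else G y i)"
      by (cases "i \<le> n") (auto intro!: continuous_on_product_then_coordinatewise[OF contk] contG)
  qed
  obtain g where g: "continuous_on K g" "g ` K \<subseteq> punctured n" "\<And>z. z \<in> K0 \<Longrightarrow> g z = v (z, 1)"
  proof (rule homotopic_extendable[OF K(1) K0 open_punctured contv _ contk'])
    show "v ` (K0 \<times> {0..1}) \<subseteq> punctured n"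
    proof clarify
      fix y and t :: real assume "y \<in> K0" "t \<in> {0..1}"
      then have "h (y, t) \<in> punctured n" using nz K0 by auto
      then show "v (y, t) \<in> punctured n" by (subst punct_cong[of _ "h (y,t)"]) (auto simp: v_def)
    qed
    show "k ` K \<subseteq> punctured n"
    proof clarify
      fix y assume "y \<in> K"
      then have "h (y, 0) \<in> punctured n" using nz by auto
      then show "k y \<in> punctured n" by (subst punct_cong[of _ "h (y,0)"]) (auto simp: k_def)
    qed
    show "v (z, 0) = k z" if "z \<in> K0" for z using that G by (auto simp: v_def k_def)
  qed (blast intro: that)
  moreover have "v (z, 1) = f z" if "z \<in> K0" for z
    using G(2)[OF that] by (auto simp: v_def h_def F_def fun_eq_iff)
  ultimately show thesis using that by auto
qed

subsection \<open>Cubes and Brouwer's theorem\<close>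

definition cube :: "nat \<Rightarrow> (nat \<Rightarrow> real) set"
  where "cube m = {q. (\<forall>i<m. q i \<in> {0..1}) \<and> (\<forall>i\<ge>m. q i = 0)}"

definition cube_frontier :: "nat \<Rightarrow> (nat \<Rightarrow> real) set"
  where "cube_frontier m = {q \<in> cube m. \<exists>i<m. q i = 0 \<or> q i = 1}"

lemma cube_range: "q \<in> cube m \<Longrightarrow> q i \<in> {0..1}"
  by (cases "i < m") (auto simp: cube_def)

lemma compact_cube: "compact (cube m)"
proof -
  have "cube m = PiE UNIV (\<lambda>i. if i < m then {0..1} else {0})"
  proof (intro set_eqI iffI)
    fix q assume "q \<in> cube m"
    then show "q \<in> PiE UNIV (\<lambda>i. if i < m then {0..1} else {0})"
      by (simp add: cube_def PiE_iff)
  next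
    fix q assume q: "q \<in> PiE UNIV (\<lambda>i. if i < m then {0..1} else {0::real})"
    have "q i \<in> (if i < m then {0..1} else {0})" for i by (rule PiE_mem[OF q]) simp
    then show "q \<in> cube m" unfolding cube_def by (smt (verit) mem_Collect_eq not_le singletonD)
  qed
  then have "compactin (product_topology (\<lambda>i. euclidean) UNIV) (cube m)"
    by (simp add: compactin_PiE)
  then show ?thesis by (simp add: euclidean_product_topology)
qed

lemma closed_cube: "closed (cube m)"
  using compact_cube compact_imp_closed by blast

lemma closed_cube_frontier: "closed (cube_frontier m)"
proof -
  have "closed {q::nat \<Rightarrow> real. q i = c}" for i c
    by (intro closed_Collect_eq continuous_on_product_coordinates continuous_intros)
  then have "closed (cube m \<inter> (\<Union>i<m. {q. q i = 0} \<union> {q. q i = 1}))"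
    by (intro closed_Int closed_cube closed_UN closed_Un) auto
  moreover have "cube m \<inter> (\<Union>i<m. {q. q i = 0} \<union> {q. q i = 1}) = cube_frontier m"
    by (auto simp: cube_frontier_def)
  ultimately show ?thesis by simp
qed

lemma cube_frontier_subset: "cube_frontier m \<subseteq> cube m"
  by (auto simp: cube_frontier_def)

section \<open>Zeros of maps on the cube\<close>

lemma tendsto_fun_iff:
  fixes f :: "'b \<Rightarrow> 'i \<Rightarrow> 'c::topological_space"
  shows "(f \<longlongrightarrow> l) F \<longleftrightarrow> (\<forall>i. ((\<lambda>x. f x i) \<longlongrightarrow> l i) F)"
  using limitin_componentwise[of "\<lambda>i::'i. euclidean :: 'c topology" UNIV f l F]
  by (simp add: euclidean_product_topology)

text \<open>Kuhn's combinatorial lemma, with grid points labelled by the sign of each coordinate of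
  \<open>F\<close>, yields for every mesh \<open>1 / p\<close> a cell on which each coordinate takes
  both weak signs. A limit of such cells is a common zero.\<close>

lemma Poincare_Miranda:
  fixes F :: "(nat \<Rightarrow> real) \<Rightarrow> nat \<Rightarrow> real"
  assumes F: "continuous_on (cube n) F"
    and F0: "\<And>q i. q \<in> cube n \<Longrightarrow> i < n \<Longrightarrow> q i = 0 \<Longrightarrow> F q i < 0"
    and F1: "\<And>q i. q \<in> cube n \<Longrightarrow> i < n \<Longrightarrow> q i = 1 \<Longrightarrow> F q i > (0::real)"
  obtains q where "q \<in> cube n" "\<And>i. i < n \<Longrightarrow> F q i = 0"
proof -
  define emb where "emb = (\<lambda>p (x::nat \<Rightarrow> nat) i. if i < n then real (x i) / real p else 0)"
  have emb: "emb p x \<in> cube n" if "p > 0" "\<forall>i<n. x i \<le> p" for p x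
    using that by (auto simp: emb_def cube_def)
  have approx: "\<exists>a r s. a \<in> cube n \<and> (\<forall>i<n. r i \<in> cube n \<and> s i \<in> cube n \<and> F (r i) i \<ge> 0 \<and> F (s i) i \<le> 0 \<and>
      (\<forall>j. \<bar>r i j - a j\<bar> \<le> 1 / real p \<and> \<bar>s i j - a j\<bar> \<le> 1 / real p))" if p: "p > 0" for p :: nat
  proof -
    \<comment> \<open>The sign conditions on opposite faces become the boundary conditions on labels
      in Kuhn's lemma.\<close>
    define label where "label = (\<lambda>x i. if F (emb p x) i \<ge> 0 then 1 else 0::nat)"
    have l0: "label x i = 0" if "\<forall>i<n. x i \<le> p" "i < n" "x i = 0" for x i
    proof -
      have "F (emb p x) i < 0" using that by (intro F0 emb p) (auto simp: emb_def)
      then show ?thesis by (simp add: label_def)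
    qed
    have l1: "label x i = 1" if "\<forall>i<n. x i \<le> p" "i < n" "x i = p" for x i
    proof -
      have "F (emb p x) i > 0" using that p by (intro F1 emb p) (auto simp: emb_def)
      then show ?thesis by (simp add: label_def)
    qed
    obtain q where q: "\<forall>i<n. q i < p"
      "\<forall>i<n. \<exists>r s. (\<forall>j<n. q j \<le> r j \<and> r j \<le> q j + 1) \<and> (\<forall>j<n. q j \<le> s j \<and> s j \<le> q j + 1) \<and> label r i \<noteq> label s i"
      by (rule kuhn_lemma[OF p, of n label]) (use l0 l1 in \<open>auto simp: label_def\<close>)
    have near: "\<bar>emb p r j - emb p q j\<bar> \<le> 1 / real p" if "\<forall>j<n. q j \<le> r j \<and> r j \<le> q j + 1" for r j
    proof (cases "j < n")
      case True
      then have "q j \<le> r j" "r j \<le> q j + 1" using that by auto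
      then have "\<bar>real (r j) - real (q j)\<bar> \<le> 1" by linarith
      then show ?thesis using True p by (simp add: emb_def diff_divide_distrib[symmetric] divide_right_mono)
    qed (auto simp: emb_def)
    have "\<exists>r s. r \<in> cube n \<and> s \<in> cube n \<and> F r i \<ge> 0 \<and> F s i \<le> 0 \<and>
      (\<forall>j. \<bar>r j - emb p q j\<bar> \<le> 1 / real p \<and> \<bar>s j - emb p q j\<bar> \<le> 1 / real p)" if i: "i < n" for i
    proof -
      obtain r s where rs: "\<forall>j<n. q j \<le> r j \<and> r j \<le> q j + 1" "\<forall>j<n. q j \<le> s j \<and> s j \<le> q j + 1"
        "label r i \<noteq> label s i" using q(2) i by blast
      have "r j \<le> p" "s j \<le> p" if "j < n" for j
      proof -
        have "r j \<le> q j + 1" "s j \<le> q j + 1" "q j < p" using rs(1,2) q(1) that by blast+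
        then show "r j \<le> p" "s j \<le> p" by linarith+
      qed
      then have "emb p r \<in> cube n" "emb p s \<in> cube n" using emb p by auto
      moreover have "(F (emb p r) i \<ge> 0 \<and> F (emb p s) i \<le> 0) \<or> (F (emb p s) i \<ge> 0 \<and> F (emb p r) i \<le> 0)"
        using rs(3) by (auto simp: label_def split: if_splits)
      ultimately show ?thesis using near[OF rs(1)] near[OF rs(2)] by blast
    qed
    then obtain r s where "\<And>i. i < n \<Longrightarrow> r i \<in> cube n \<and> s i \<in> cube n \<and> F (r i) i \<ge> 0 \<and> F (s i) i \<le> 0 \<and>
      (\<forall>j. \<bar>r i j - emb p q j\<bar> \<le> 1 / real p \<and> \<bar>s i j - emb p q j\<bar> \<le> 1 / real p)" by metis
    moreover have "emb p q \<in> cube n" using emb[OF p] q(1) by (simp add: less_imp_le)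
    ultimately show ?thesis by (intro exI[of _ "emb p q"] exI[of _ r] exI[of _ s]) simp
  qed
  have "\<exists>a r s. a \<in> cube n \<and> (\<forall>i<n. r i \<in> cube n \<and> s i \<in> cube n \<and> F (r i) i \<ge> 0 \<and> F (s i) i \<le> 0 \<and>
      (\<forall>j. \<bar>r i j - a j\<bar> \<le> 1 / real (Suc k) \<and> \<bar>s i j - a j\<bar> \<le> 1 / real (Suc k)))" for k
    by (rule approx) simp
  then obtain a r s where ars: "\<And>k. a k \<in> cube n"
    "\<And>k i. i < n \<Longrightarrow> r k i \<in> cube n \<and> s k i \<in> cube n \<and> F (r k i) i \<ge> 0 \<and> F (s k i) i \<le> 0 \<and>
      (\<forall>j. \<bar>r k i j - a k j\<bar> \<le> 1 / real (Suc k) \<and> \<bar>s k i j - a k j\<bar> \<le> 1 / real (Suc k))"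
    by metis
  obtain q \<sigma> where q: "q \<in> cube n" "strict_mono \<sigma>" "(a \<circ> \<sigma>) \<longlonglongrightarrow> q"
    using compact_cube[of n] ars(1) by (metis compact_def)
  \<comment> \<open>The points \<open>r k i\<close> and \<open>s k i\<close> lie within
    \<open>1 / Suc k\<close> of \<open>a k\<close>, so both converge to \<open>q\<close>, and the
    two weak inequalities give equality there.\<close>
  have conv: "(\<lambda>k. b (\<sigma> k)) \<longlonglongrightarrow> q" if "\<And>k j. \<bar>b k j - a k j\<bar> \<le> 1 / real (Suc k)" for b
  proof (unfold tendsto_fun_iff, rule allI)
    fix j
    have "(\<lambda>k. 1 / real (Suc (\<sigma> k))) \<longlonglongrightarrow> 0"
      using LIMSEQ_subseq_LIMSEQ[OF LIMSEQ_inverse_real_of_nat q(2)] by (simp add: o_def inverse_eq_divide)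
    moreover have "\<forall>\<^sub>F k in sequentially. norm (b (\<sigma> k) j - a (\<sigma> k) j) \<le> 1 / real (Suc (\<sigma> k))"
      using that by (intro always_eventually allI) (simp only: real_norm_def)
    ultimately have "(\<lambda>k. b (\<sigma> k) j - a (\<sigma> k) j) \<longlonglongrightarrow> 0"
      by (rule Lim_null_comparison[rotated])
    moreover have "(\<lambda>k. a (\<sigma> k) j) \<longlonglongrightarrow> q j" using q(3) by (simp add: tendsto_fun_iff o_def)
    ultimately show "(\<lambda>k. b (\<sigma> k) j) \<longlonglongrightarrow> q j"
      using tendsto_add[of "\<lambda>k. b (\<sigma> k) j - a (\<sigma> k) j" 0 sequentially "\<lambda>k. a (\<sigma> k) j" "q j"] by simp
  qed
  have Fconv: "(\<lambda>k. F (b (\<sigma> k)) i) \<longlonglongrightarrow> F q i"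
    if "\<And>k j. \<bar>b k j - a k j\<bar> \<le> 1 / real (Suc k)" "\<And>k. b k \<in> cube n" for b i
    by (rule continuous_on_tendsto_compose[OF continuous_on_product_then_coordinatewise[OF F] conv])
      (use that q in auto)
  have "F q i = 0" if i: "i < n" for i
  proof (rule antisym)
    show "F q i \<ge> 0"
      by (rule LIMSEQ_le_const[OF Fconv[of "\<lambda>k. r k i" i]]) (use ars(2)[OF i] in auto)
    show "F q i \<le> 0"
      by (rule LIMSEQ_le_const2[OF Fconv[of "\<lambda>k. s k i" i]]) (use ars(2)[OF i] in auto)
  qed
  then show thesis using that q(1) by blast
qed

section \<open>An essential map from the cube to the sphere\<close>

definition basepoint :: "nat \<Rightarrow> nat \<Rightarrow> real"
  where "basepoint n = (\<lambda>i. if i = n then 1 else 0)"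

lemma basepoint_punctured: "basepoint n \<in> punctured n"
  by (auto simp: basepoint_def punctured_def)

text \<open>The weight \<open>bump n\<close> is \<open>1\<close> at the centre of the cube and \<open>0\<close> on its frontier, so
  \<open>wrap n\<close> wraps the cube once around the origin, collapsing the frontier to a point.\<close>

definition bump :: "nat \<Rightarrow> (nat \<Rightarrow> real) \<Rightarrow> real"
  where "bump n q = (\<Prod>i<n. 4 * q i * (1 - q i))"

definition wrap :: "nat \<Rightarrow> (nat \<Rightarrow> real) \<Rightarrow> nat \<Rightarrow> real"
  where "wrap n q = (\<lambda>i. if i < n then bump n q * (q i - 1/2)
    else if i = n then 1 - 2 * bump n q else 0)"

lemma continuous_on_wrap: "continuous_on S (wrap n)"
proof -
  have c: "continuous_on S (\<lambda>q::nat \<Rightarrow> real. q i)" for i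
    by (rule continuous_on_product_then_coordinatewise) (rule continuous_on_id)
  have "continuous_on S (\<lambda>q. wrap n q i)" for i
    unfolding wrap_def bump_def by (cases "i < n"; cases "i = n") (auto intro!: continuous_intros c)
  then show ?thesis by (rule continuous_on_coordinatewise_then_product)
qed

lemma bump_nonneg: "q \<in> cube n \<Longrightarrow> bump n q \<ge> 0"
  unfolding bump_def by (intro prod_nonneg) (auto simp: cube_def)

lemma bump_centre:
  assumes "\<And>i. i < n \<Longrightarrow> q i = 1/2"
  shows "bump n q = 1"
proof -
  have "4 * q i * (1 - q i) = 1" if "i < n" for i
    unfolding assms[OF that] by simp
  then show ?thesis unfolding bump_def by (intro prod.neutral) simp
qed

lemma wrap_frontier: "q \<in> cube_frontier n \<Longrightarrow> wrap n q = basepoint n"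
proof -
  assume "q \<in> cube_frontier n"
  then have "bump n q = 0" by (auto simp: bump_def cube_frontier_def)
  then show ?thesis by (auto simp: wrap_def basepoint_def)
qed

text \<open>The last coordinate vanishes only if the bump is \<open>1/2\<close>; the other
  coordinates then vanish only at the centre, where the bump is \<open>1\<close>.\<close>

lemma wrap_punctured: "wrap n q \<in> punctured n"
proof (rule ccontr)
  assume "wrap n q \<notin> punctured n"
  then have 0: "wrap n q i = 0" if "i \<le> n" for i using that by (auto simp: punctured_def)
  have "bump n q = 1/2" using 0[of n] by (simp add: wrap_def)
  then have "q i = 1/2" if "i < n" for i using 0[of i] that by (simp add: wrap_def)
  then have "bump n q = 1" by (rule bump_centre)
  then show False using \<open>bump n q = 1/2\<close> by simp
qed

text \<open>A null-homotopy relative to the frontier is a map \<open>k\<close> on a cube of one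
  dimension more, with time as last coordinate. On the frontier of that cube \<open>k\<close> is
  joined to \<open>p i - 1/2\<close> by straight lines avoiding the origin, so the latter would
  extend over the cube without zeros, against Poincare-Miranda.\<close>

lemma wrap_essential:
  fixes H :: "(nat \<Rightarrow> real) \<times> real \<Rightarrow> nat \<Rightarrow> real"
  assumes H: "continuous_on (cube n \<times> {0..1}) H" "H ` (cube n \<times> {0..1}) \<subseteq> punctured n"
    and H0: "\<And>q. q \<in> cube n \<Longrightarrow> H (q, 0) = wrap n q"
    and H1: "\<And>q. q \<in> cube n \<Longrightarrow> H (q, 1) = basepoint n"
    and Hf: "\<And>q t. q \<in> cube_frontier n \<Longrightarrow> t \<in> {0..1} \<Longrightarrow> H (q, t) = basepoint n"
  shows False
proof -
  define k where "k = (\<lambda>p::nat \<Rightarrow> real. H (p(n := 0), p n))"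
  have low: "p(n := 0) \<in> cube n" "p n \<in> {0..1}" if "p \<in> cube (Suc n)" for p
    using that by (auto simp: cube_def)
  have cp: "continuous_on S (\<lambda>p::nat \<Rightarrow> real. p i)" for S i
    by (rule continuous_on_product_then_coordinatewise) (rule continuous_on_id)
  have upd: "continuous_on S (\<lambda>p::nat \<Rightarrow> real. p(n := 0))" for S
  proof (rule continuous_on_coordinatewise_then_product)
    show "continuous_on S (\<lambda>p::nat \<Rightarrow> real. (p(n := 0)) i)" for i
      by (cases "i = n") (auto intro!: cp)
  qed
  have k: "continuous_on (cube (Suc n)) k"
    unfolding k_def
    by (rule continuous_on_compose2[OF H(1) continuous_on_Pair[OF upd cp]]) (use low in auto)
  have k': "k ` cube (Suc n) \<subseteq> punctured n"
    unfolding k_def using H(2) low by auto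
  define h where "h = (\<lambda>(p::nat \<Rightarrow> real, s) i. s * (p i - 1/2) + (1 - s) * k p i)"
  have conth: "continuous_on (cube_frontier (Suc n) \<times> {0..1}) h"
  proof -
    let ?D = "cube_frontier (Suc n) \<times> {0..1::real}"
    have ck: "continuous_on ?D (\<lambda>x. k (fst x) i)" for i
      by (rule continuous_on_compose2[OF continuous_on_product_then_coordinatewise[OF k] continuous_on_fst[OF continuous_on_id]])
        (use cube_frontier_subset in auto)
    have cx: "continuous_on ?D (\<lambda>x. fst x i)" for i
      by (rule continuous_on_product_then_coordinatewise[OF continuous_on_fst[OF continuous_on_id]])
    show ?thesis unfolding h_def case_prod_unfold
      by (rule continuous_on_coordinatewise_then_product) (intro continuous_intros ck cx)
  qed
  have nz: "h (p, s) \<in> punctured n" if p: "p \<in> cube_frontier (Suc n)" and s: "s \<in> {0..1}" for p s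
  proof (rule ccontr)
    assume "h (p, s) \<notin> punctured n"
    then have 0: "s * (p i - 1/2) + (1 - s) * k p i = 0" if "i \<le> n" for i
      using that by (auto simp: punctured_def h_def)
    have pc: "p \<in> cube (Suc n)" using p by (auto simp: cube_frontier_def)
    show False
    \<comment> \<open>On the bottom face \<open>k\<close> is \<open>wrap n\<close>, so the first
      \<open>n\<close> coordinates of \<open>h\<close> are a common nonnegative multiple of
      \<open>p i - 1/2\<close>. If the multiple vanishes, the last coordinate is \<open>1\<close>;
      otherwise \<open>p\<close> is the centre of the face, where the last coordinate is
      negative.\<close>
    proof (cases "p n = 0")
      case True
      define w where "w = bump n (p(n := 0))"
      have w: "w \<ge> 0" unfolding w_def by (rule bump_nonneg[OF low(1)[OF pc]])
      have kp: "k p = wrap n (p(n := 0))" using True H0[OF low(1)[OF pc]] by (simp add: k_def)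
      have i: "(s + (1 - s) * w) * (p i - 1/2) = 0" if "i < n" for i
      proof -
        have "s * (p i - 1/2) + (1 - s) * (w * (p i - 1/2)) = 0"
          using 0[of i] that unfolding kp wrap_def w_def[symmetric] by simp
        then show ?thesis by (simp only: distrib_right mult.assoc)
      qed
      have n: "- s / 2 + (1 - s) * (1 - 2 * w) = 0"
        using 0[of n] True unfolding kp wrap_def w_def[symmetric] by simp
      show False
      proof (cases "s + (1 - s) * w = 0")
        case True
        then have "s = 0" using s w by (smt (verit) atLeastAtMost_iff mult_nonneg_nonneg)
        then show False using True n by simp
      next
        case False
        then have "p j = 1/2" if "j < n" for j using i[OF that] by simp
        then have "w = 1" unfolding w_def by (intro bump_centre) simp
        then show False using n s by simp
      qed
    next
      case False
      \<comment> \<open>On the top and the sides \<open>k\<close> is constant. Vanishing of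
        \<open>h\<close> then forces \<open>p i = 1/2\<close> for \<open>i < n\<close>, so
        \<open>p\<close> lies on the top face, where the last coordinate of \<open>h\<close> is
        positive.\<close>
      have kp: "k p = basepoint n"
      proof (cases "p n = 1")
        case True
        then show ?thesis using H1[OF low(1)[OF pc]] by (simp add: k_def)
      next
        case 1: False
        obtain i where "i < Suc n" "p i = 0 \<or> p i = 1" using p by (auto simp: cube_frontier_def)
        then have "i < n" "p i = 0 \<or> p i = 1" using 1 False by (auto simp: less_Suc_eq)
        then have "p(n := 0) \<in> cube_frontier n"
          using low(1)[OF pc] by (auto simp: cube_frontier_def)
        then show ?thesis using Hf low(2)[OF pc] by (simp add: k_def)
      qed
      have s0: "s \<noteq> 0" using 0[of n] by (auto simp: kp basepoint_def)
      then have half: "p i = 1/2" if "i < n" for i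
        using 0[of i] that by (simp add: kp basepoint_def)
      have "p n = 1"
      proof -
        obtain i where "i < Suc n" "p i = 0 \<or> p i = 1" using p by (auto simp: cube_frontier_def)
        then show ?thesis using half[of i] False by (cases "i = n") auto
      qed
      then show False using 0[of n] s by (simp add: kp basepoint_def)
    qed
  qed
  obtain g where g: "continuous_on (cube (Suc n)) g" "g ` cube (Suc n) \<subseteq> punctured n"
    "\<And>p. p \<in> cube_frontier (Suc n) \<Longrightarrow> g p = h (p, 1)"
  proof (rule homotopic_extendable[OF compact_cube closed_cube_frontier cube_frontier_subset
        open_punctured conth _ k k'])
    show "h ` (cube_frontier (Suc n) \<times> {0..1}) \<subseteq> punctured n" using nz by auto
    show "h (z, 0) = k z" for z by (simp add: h_def)
  qed (blast intro: that)
  obtain q where q: "q \<in> cube (Suc n)" "\<And>i. i < Suc n \<Longrightarrow> g q i = 0"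
  proof (rule Poincare_Miranda[OF g(1)])
    fix q i assume q: "q \<in> cube (Suc n)" "i < Suc n"
    show "g q i < 0" if "q i = 0"
    proof -
      have "q \<in> cube_frontier (Suc n)" using that q by (auto simp: cube_frontier_def)
      then show ?thesis using g(3) that by (simp add: h_def)
    qed
    show "g q i > 0" if "q i = 1"
    proof -
      have "q \<in> cube_frontier (Suc n)" using that q by (auto simp: cube_frontier_def)
      then show ?thesis using g(3) that by (simp add: h_def)
    qed
  qed (blast intro: that)
  then show False using g(2) by (auto simp: punctured_def image_subset_iff less_Suc_eq_le)
qed

subsection \<open>Extension of maps to iterated loop spaces\<close>

text \<open>Uncurried, \<open>f\<close> is a continuous map from \<open>K\<close> to the \<open>m\<close>-fold loop space of \<open>punctured n\<close>.\<close>

definition loops :: "nat \<Rightarrow> nat \<Rightarrow> 'a::metric_space set \<Rightarrow> ('a \<times> (nat \<Rightarrow> real) \<Rightarrow> nat \<Rightarrow> real) \<Rightarrow> bool"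
  where "loops n m K f \<longleftrightarrow> continuous_on (K \<times> cube m) f \<and> f ` (K \<times> cube m) \<subseteq> punctured n \<and>
    (\<forall>x\<in>K. \<forall>q\<in>cube_frontier m. f (x, q) = basepoint n)"

definition loops_extend :: "nat \<Rightarrow> nat \<Rightarrow> 'a::metric_space set \<Rightarrow> bool"
  where "loops_extend n m X \<longleftrightarrow> (\<forall>K K0 f. compact K \<and> K \<subseteq> X \<and> closed K0 \<and> K0 \<subseteq> K \<and> loops n m K0 f \<longrightarrow>
    (\<exists>g. loops n m K g \<and> (\<forall>x\<in>K0. \<forall>q\<in>cube m. g (x, q) = f (x, q))))"

lemma loopsD:
  assumes "loops n m K f"
  shows "continuous_on (K \<times> cube m) f"
    "\<And>x q. x \<in> K \<Longrightarrow> q \<in> cube m \<Longrightarrow> f (x, q) \<in> punctured n"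
    "\<And>x q. x \<in> K \<Longrightarrow> q \<in> cube_frontier m \<Longrightarrow> f (x, q) = basepoint n"
  using assms by (auto simp: loops_def image_subset_iff)

section \<open>Faces of cubes\<close>

lemma cube_frontierD: "q \<in> cube_frontier m \<Longrightarrow> q \<in> cube m"
  using cube_frontier_subset by blast

lemma cube_upd: "q \<in> cube m \<Longrightarrow> t \<in> {0..1} \<Longrightarrow> q(m := t) \<in> cube (Suc m)"
  by (auto simp: cube_def less_Suc_eq)

lemma cube_upd_same: "p \<in> cube (Suc m) \<Longrightarrow> t \<in> {0..1} \<Longrightarrow> p(m := t) \<in> cube (Suc m)"
  by (auto simp: cube_def less_Suc_eq)

lemma cube_upd_zero: "p \<in> cube (Suc m) \<Longrightarrow> p(m := 0) \<in> cube m"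
  by (auto simp: cube_def)

lemma frontier_upd:
  assumes "q \<in> cube_frontier m" "t \<in> {0..1}"
  shows "q(m := t) \<in> cube_frontier (Suc m)"
proof -
  obtain i where i: "i < m" "q i = 0 \<or> q i = 1" "q \<in> cube m"
    using assms(1) by (auto simp: cube_frontier_def)
  then have "(q(m := t)) i = 0 \<or> (q(m := t)) i = 1" by simp
  then show ?thesis
    using i(1) cube_upd[OF i(3) assms(2)] unfolding cube_frontier_def by (blast intro: less_SucI)
qed

lemma frontier_upd_end:
  "q \<in> cube m \<Longrightarrow> t = 0 \<or> t = 1 \<Longrightarrow> q(m := t) \<in> cube_frontier (Suc m)"
  using cube_upd[of q m t] by (auto simp: cube_frontier_def)

lemma frontier_cases:
  assumes "p \<in> cube_frontier (Suc m)"
  obtains "p(m := 0) \<in> cube_frontier m" | "p m = 0" | "p m = 1"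
proof -
  obtain i where i: "i < Suc m" "p i = 0 \<or> p i = 1" "p \<in> cube (Suc m)"
    using assms by (auto simp: cube_frontier_def)
  show thesis
  proof (cases "i = m")
    case False
    then have "i < m" using i by auto
    then have "p(m := 0) \<in> cube_frontier m"
      using i cube_upd_zero[OF i(3)] by (auto simp: cube_frontier_def)
    then show thesis using that by blast
  qed (use i that in blast)
qed

lemma continuous_on_upd:
  fixes f :: "'z::topological_space \<Rightarrow> nat \<Rightarrow> real"
  assumes "continuous_on S f" "continuous_on S t"
  shows "continuous_on S (\<lambda>z. (f z)(m := t z))"
proof (rule continuous_on_coordinatewise_then_product)
  show "continuous_on S (\<lambda>z. ((f z)(m := t z)) i)" for i
    using assms continuous_on_product_then_coordinatewise[OF assms(1)] by (cases "i = m") auto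
qed

lemma continuous_on_compose_Pair:
  assumes "continuous_on (A \<times> B) F" "continuous_on S f" "continuous_on S g"
    and "\<And>z. z \<in> S \<Longrightarrow> f z \<in> A \<and> g z \<in> B"
  shows "continuous_on S (\<lambda>z. F (f z, g z))"
  by (rule continuous_on_compose2[OF assms(1) continuous_on_Pair[OF assms(2,3)]])
    (use assms(4) in auto)

text \<open>Contract the loop \<open>t \<mapsto> g (y, q(m := t))\<close> to its start for \<open>y\<close> off the ball; the homotopy extension \<open>H\<close>
  of this ends over the ball at an \<open>m\<close>-fold loop \<open>a\<close> that need not be trivial. The extension \<open>A\<close> of \<open>a\<close>
  composed with \<open>\<phi>\<close> closes it up. On \<open>K0\<close> the concatenation \<open>G\<close> is \<open>g\<close> run at double speed and then
  constant, which is undone by a reparametrisation.\<close>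

lemma loops_extend_ball:
  fixes X :: "'a::metric_space set" and \<phi> :: "'a \<times> real \<Rightarrow> 'a"
  assumes ext: "loops_extend n m X"
    and C': "compact C'" "C' \<subseteq> X" and C: "closed C" "C \<subseteq> C'" "C' - ball x \<rho> \<subseteq> C"
    and K0: "closed K0" "K0 \<subseteq> C" and g: "loops n (Suc m) C g"
    and \<phi>: "continuous_on (X \<times> {0..1}) \<phi>" "\<phi> ` (X \<times> {0..1}) \<subseteq> X"
      "\<And>y. y \<in> X \<Longrightarrow> \<phi> (y, 0) = y" "\<And>y. y \<in> X \<Longrightarrow> \<rho> \<le> dist x (\<phi> (y, 1))"
      "\<And>y t. y \<in> K0 \<Longrightarrow> t \<in> {0..1} \<Longrightarrow> \<rho> \<le> dist x (\<phi> (y, t))"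
  obtains g' where "loops n (Suc m) C' g'"
    "\<And>y q. y \<in> K0 \<Longrightarrow> q \<in> cube (Suc m) \<Longrightarrow> g' (y, q) = g (y, q)"
proof -
  note gD = loopsD[OF g]
  define b where "b = basepoint n"
  have bP: "b \<in> punctured n" by (simp add: b_def basepoint_punctured)
  define I where "I = {0..1::real}"
  have I: "closed I" "compact I" "0 \<in> I" "1 \<in> I" by (auto simp: I_def)
  have closedC': "closed C'" using C' compact_imp_closed by blast
  define E where "E = C' - ball x \<rho>"
  have E: "closed E" "E \<subseteq> C" "E \<subseteq> C'"
    using closedC' C by (auto simp: E_def intro: closed_Diff)
  have K0E: "K0 \<subseteq> E"
    using K0 C C' \<phi>(5)[of _ 0] \<phi>(3) by (fastforce simp: E_def)
  define D where "D = E \<times> cube m \<union> C' \<times> cube_frontier m"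
  have D: "closed D" "D \<subseteq> C' \<times> cube m"
    using E closedC' closed_cube closed_cube_frontier cube_frontierD
    by (auto simp: D_def intro!: closed_Un closed_Times)
  \<comment> \<open>The last cube coordinate of \<open>g\<close> is read as time. The clauses are
    compatible where the two parts of \<open>D\<close> meet, because \<open>g\<close> has the value
    \<open>b\<close> on the cube frontier.\<close>
  define h where "h = (\<lambda>((y, q), t). if y \<in> E then g (y, q(m := t)) else b)"
  have conth: "continuous_on (D \<times> I) h"
  proof -
    have "continuous_on ((E \<times> cube m) \<times> I \<union> (C' \<times> cube_frontier m) \<times> I) (\<lambda>z. if fst (fst z) \<in> E
        then g (fst (fst z), (snd (fst z))(m := snd z)) else b)"
    proof (rule continuous_on_cases)
      show "continuous_on ((E \<times> cube m) \<times> I) (\<lambda>z. g (fst (fst z), (snd (fst z))(m := snd z)))"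
        by (rule continuous_on_compose_Pair[OF gD(1)])
          (use E in \<open>auto intro!: continuous_on_upd continuous_on_fst continuous_on_snd continuous_on_id cube_upd simp: I_def\<close>)
    qed (use E I closedC' closed_cube closed_cube_frontier gD(3) frontier_upd
        in \<open>auto intro!: closed_Times simp: I_def b_def\<close>)
    moreover have "D \<times> I = (E \<times> cube m) \<times> I \<union> (C' \<times> cube_frontier m) \<times> I"
      by (auto simp: D_def)
    ultimately show ?thesis by (simp add: h_def case_prod_unfold)
  qed
  have him: "h ` (D \<times> I) \<subseteq> punctured n"
    using gD(2) bP E cube_upd cube_frontierD by (auto simp: h_def D_def I_def)
  obtain H where H: "continuous_on ((C' \<times> cube m) \<times> I) H" "H ` ((C' \<times> cube m) \<times> I) \<subseteq> punctured n"
    "\<And>z. z \<in> C' \<times> cube m \<Longrightarrow> H (z, 0) = b" "\<And>z t. z \<in> D \<Longrightarrow> t \<in> I \<Longrightarrow> H (z, t) = h (z, t)"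
    unfolding I_def
  proof (rule homotopy_extension[where h = h and k = "\<lambda>_. b",
        OF compact_Times[OF C'(1) compact_cube] D open_punctured])
    show "h (z, 0) = b" if "z \<in> D" for z
      using that gD(3) E frontier_upd_end frontier_upd[of _ m 0]
      by (auto simp: h_def D_def b_def)
  qed (use conth him bP in \<open>auto simp: I_def\<close>)
  have HE: "H ((y, q), t) = g (y, q(m := t))" if "y \<in> E" "q \<in> cube m" "t \<in> I" for y q t
    using H(4)[of "(y, q)" t] that by (simp add: D_def h_def)
  have Hf: "H ((y, q), t) = b" if "y \<in> C'" "q \<in> cube_frontier m" "t \<in> I" for y q t
    using H(4)[of "(y, q)" t] that gD(3)[of y "q(m := t)"] frontier_upd E
    by (auto simp: D_def h_def b_def I_def)
  have HE1: "H ((y, q), 1) = b" if "y \<in> E" "q \<in> cube m" for y q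
    using HE[OF that I(4)] gD(3)[of y "q(m := 1)"] frontier_upd_end that E by (auto simp: b_def)
  \<comment> \<open>\<open>ext\<close> concerns compact sets, so it is applied to the region swept
    out by \<open>C'\<close> under \<open>\<phi>\<close>.\<close>
  define K' where "K' = C' \<union> \<phi> ` (C' \<times> I)"
  have "continuous_on (C' \<times> I) \<phi>"
    by (rule continuous_on_subset[OF \<phi>(1)]) (use C' in \<open>auto simp: I_def\<close>)
  then have K': "compact K'" "K' \<subseteq> X"
    using C' \<phi>(2) I unfolding K'_def
    by (auto intro!: compact_Un compact_continuous_image compact_Times simp: I_def)
  have closedK': "closed K'" using K' compact_imp_closed by blast
  \<comment> \<open>Off the ball \<open>a\<close> can be set to \<open>b\<close>, because on the
    overlap \<open>E\<close> with \<open>C'\<close> the homotopy \<open>H\<close> ends at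
    \<open>b\<close>. Only points inside the ball are left to \<open>A\<close>.\<close>
  define C2 where "C2 = C' \<union> (K' - ball x \<rho>)"
  have C2: "closed C2" "C2 \<subseteq> K'"
    using closedC' closedK' by (auto simp: C2_def K'_def)
  define a where "a = (\<lambda>(y, q). if y \<in> C' then H ((y, q), 1) else b)"
  have aout: "a (y, q) = b" if "y \<in> K' - ball x \<rho>" "q \<in> cube m" for y q
    using that HE1[of y q] by (auto simp: a_def E_def)
  have la: "loops n m C2 a"
    unfolding loops_def
  proof (intro conjI ballI)
    have "continuous_on (C' \<times> cube m \<union> (K' - ball x \<rho>) \<times> cube m) (\<lambda>z. if fst z \<in> C'
        then H ((fst z, snd z), 1) else b)"
    proof (rule continuous_on_cases)
      show "continuous_on (C' \<times> cube m) (\<lambda>z. H ((fst z, snd z), 1))"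
        unfolding prod.collapse by (rule continuous_on_compose_Pair[OF H(1)]) (auto intro!: continuous_on_id simp: I_def)
    qed (use closedK' closedC' closed_cube HE1 in \<open>auto intro!: closed_Times simp: E_def\<close>)
    moreover have "C2 \<times> cube m = C' \<times> cube m \<union> (K' - ball x \<rho>) \<times> cube m" by (auto simp: C2_def)
    ultimately show "continuous_on (C2 \<times> cube m) a" by (simp add: a_def case_prod_unfold)
    show "a ` (C2 \<times> cube m) \<subseteq> punctured n"
      using H(2) bP I by (auto simp: a_def image_subset_iff)
    show "a (y, q) = basepoint n" if "y \<in> C2" "q \<in> cube_frontier m" for y q
      using that Hf I by (auto simp: a_def b_def)
  qed
  have "\<exists>A. loops n m K' A \<and> (\<forall>y\<in>C2. \<forall>q\<in>cube m. A (y, q) = a (y, q))"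
    by (rule ext[unfolded loops_extend_def, THEN spec, THEN spec, THEN spec, THEN mp])
      (simp add: la K' C2)
  then obtain A where A: "loops n m K' A" "\<And>y q. y \<in> C2 \<Longrightarrow> q \<in> cube m \<Longrightarrow> A (y, q) = a (y, q)"
    by metis
  note AD = loopsD[OF A(1)]
  have \<phi>K: "\<phi> (y, t) \<in> K'" if "y \<in> C'" "t \<in> I" for y t
    using that by (auto simp: K'_def)
  have Aout: "A (y, q) = b" if "y \<in> K'" "\<rho> \<le> dist x y" "q \<in> cube m" for y q
    using A(2)[of y q] aout[of y q] that by (auto simp: C2_def)
  \<comment> \<open>The first half runs from \<open>b\<close> to \<open>a\<close>; the second
    follows \<open>A\<close> along the track of \<open>y\<close> under \<open>\<phi>\<close>, from
    \<open>a\<close> back to \<open>b\<close>, because the track ends off the ball.\<close>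
  define G where "G = (\<lambda>(y, p). if p m \<le> 1/2 then H ((y, p(m := 0)), 2 * p m)
    else A (\<phi> (y, 2 * p m - 1), p(m := 0)))"
  have pm: "p m \<in> I" if "p \<in> cube (Suc m)" for p using cube_range[OF that] by (simp add: I_def)
  have contG: "continuous_on (C' \<times> cube (Suc m)) G"
  proof -
    let ?S = "{z \<in> C' \<times> cube (Suc m). snd z m \<le> 1/2}" and ?T = "{z \<in> C' \<times> cube (Suc m). 1/2 \<le> snd z m}"
    have cm: "continuous_on S (\<lambda>z::'a \<times> (nat \<Rightarrow> real). snd z m)" for S
      by (rule continuous_on_product_then_coordinatewise) (intro continuous_on_snd continuous_on_id)
    have c0: "continuous_on S (\<lambda>z::'a \<times> (nat \<Rightarrow> real). (snd z)(m := 0))" for S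
      by (intro continuous_on_upd continuous_on_snd continuous_on_id continuous_on_const)
    have cl: "closed (C' \<times> cube (Suc m))" using closedC' closed_cube by (rule closed_Times)
    have "continuous_on (?S \<union> ?T) (\<lambda>z. if snd z m \<le> 1/2 then H ((fst z, (snd z)(m := 0)), 2 * snd z m)
      else A (\<phi> (fst z, 2 * snd z m - 1), (snd z)(m := 0)))"
    proof (rule continuous_on_cases)
      have "?S = C' \<times> cube (Suc m) \<inter> (\<lambda>z. snd z m) -` {..1/2}" by auto
      then show "closed ?S" using continuous_closed_preimage[OF cm cl closed_atMost] by simp
      have "?T = C' \<times> cube (Suc m) \<inter> (\<lambda>z. snd z m) -` {1/2..}" by auto
      then show "closed ?T" using continuous_closed_preimage[OF cm cl closed_atLeast] by simp
      show "continuous_on ?S (\<lambda>z. H ((fst z, (snd z)(m := 0)), 2 * snd z m))"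
        by (rule continuous_on_compose_Pair[OF H(1)])
          (use pm cube_upd_zero in \<open>auto intro!: continuous_on_Pair continuous_on_fst continuous_on_id c0
            continuous_on_mult continuous_on_const cm simp: I_def\<close>)
      show "continuous_on ?T (\<lambda>z. A (\<phi> (fst z, 2 * snd z m - 1), (snd z)(m := 0)))"
      proof (rule continuous_on_compose_Pair[OF AD(1) _ c0])
        show "continuous_on ?T (\<lambda>z. \<phi> (fst z, 2 * snd z m - 1))"
          by (rule continuous_on_compose_Pair[OF \<phi>(1)])
            (use pm C' in \<open>auto intro!: continuous_on_fst continuous_on_id
              continuous_on_diff continuous_on_mult continuous_on_const cm simp: I_def\<close>)
        show "\<phi> (fst z, 2 * snd z m - 1) \<in> K' \<and> (snd z)(m := 0) \<in> cube m" if "z \<in> ?T" for z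
          using that pm[of "snd z"] by (auto intro!: \<phi>K cube_upd_zero simp: I_def)
      qed
      show "\<forall>z. z \<in> ?S \<and> \<not> snd z m \<le> 1/2 \<or> z \<in> ?T \<and> snd z m \<le> 1/2 \<longrightarrow>
          H ((fst z, (snd z)(m := 0)), 2 * snd z m) = A (\<phi> (fst z, 2 * snd z m - 1), (snd z)(m := 0))"
      proof (intro allI impI)
        fix z assume "z \<in> ?S \<and> \<not> snd z m \<le> 1/2 \<or> z \<in> ?T \<and> snd z m \<le> 1/2"
        then have z: "fst z \<in> C'" "snd z \<in> cube (Suc m)" "snd z m = 1/2" by auto
        have "A (fst z, (snd z)(m := 0)) = a (fst z, (snd z)(m := 0))"
          using z cube_upd_zero by (intro A(2)) (auto simp: C2_def)
        then show "H ((fst z, (snd z)(m := 0)), 2 * snd z m) = A (\<phi> (fst z, 2 * snd z m - 1), (snd z)(m := 0))"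
          unfolding z(3) using z(1) \<phi>(3)[of "fst z"] C' by (auto simp: a_def)
      qed
    qed
    moreover have "?S \<union> ?T = C' \<times> cube (Suc m)" by auto
    ultimately show ?thesis by (simp add: G_def case_prod_unfold)
  qed
  have Gim: "G ` (C' \<times> cube (Suc m)) \<subseteq> punctured n"
  proof clarify
    fix y p assume yp: "y \<in> C'" "p \<in> cube (Suc m)"
    show "G (y, p) \<in> punctured n"
    proof (cases "p m \<le> 1/2")
      case True
      then have "((y, p(m := 0)), 2 * p m) \<in> (C' \<times> cube m) \<times> I"
        using yp pm[of p] cube_upd_zero by (auto simp: I_def)
      then show ?thesis using H(2) True by (auto simp: G_def)
    next
      case False
      then have "2 * p m - 1 \<in> I" using pm[OF yp(2)] by (auto simp: I_def)
      then show ?thesis using False AD(2)[OF \<phi>K[OF yp(1)] cube_upd_zero[OF yp(2)]]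
        by (simp add: G_def)
    qed
  qed
  have Gf: "G (y, p) = b" if yp: "y \<in> C'" "p \<in> cube_frontier (Suc m)" for y p
  proof -
    have pc: "p \<in> cube (Suc m)" using yp cube_frontierD by blast
    show ?thesis
      using yp(2)
    proof (cases rule: frontier_cases)
      case 1
      show ?thesis
      proof (cases "p m \<le> 1/2")
        case True
        then show ?thesis using Hf[OF yp(1) 1, of "2 * p m"] pm[OF pc] by (auto simp: G_def I_def)
      next
        case False
        then have "2 * p m - 1 \<in> I" using pm[OF pc] by (auto simp: I_def)
        then show ?thesis using False AD(3)[OF \<phi>K[OF yp(1)] 1] by (simp add: G_def b_def)
      qed
    next
      case 2
      then show ?thesis using H(3)[of "(y, p(m := 0))"] yp cube_upd_zero[OF pc] by (simp add: G_def)
    next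
      case 3
      then show ?thesis
        using Aout[OF \<phi>K[OF yp(1) I(4)] \<phi>(4) cube_upd_zero[OF pc]] yp C' by (auto simp: G_def)
    qed
  qed
  \<comment> \<open>Points of \<open>K0\<close> stay off the ball during the whole homotopy, so
    \<open>A\<close> is \<open>b\<close> along their tracks.\<close>
  have GK0: "G (y, p) = g (y, p(m := min 1 (2 * p m)))" if yp: "y \<in> K0" "p \<in> cube (Suc m)" for y p
  proof (cases "p m \<le> 1/2")
    case True
    then have "min 1 (2 * p m) = 2 * p m" by simp
    then show ?thesis
      using True HE[of y "p(m := 0)" "2 * p m"] K0E yp cube_upd_zero[OF yp(2)] pm[OF yp(2)]
      by (auto simp: G_def I_def)
  next
    case False
    then have t: "2 * p m - 1 \<in> I" using pm[OF yp(2)] by (auto simp: I_def)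
    have yE: "y \<in> E" "y \<in> C'" using K0E yp E by auto
    have "A (\<phi> (y, 2 * p m - 1), p(m := 0)) = b"
      by (rule Aout[OF \<phi>K[OF yE(2) t] \<phi>(5)[OF yp(1) t[unfolded I_def]] cube_upd_zero[OF yp(2)]])
    moreover have "g (y, p(m := 1)) = b"
      using gD(3)[of y "p(m := 1)"] frontier_upd_end[OF cube_upd_zero[OF yp(2)], of 1] yE E by (auto simp: b_def)
    ultimately show ?thesis using False by (simp add: G_def min_def)
  qed
  define D2 where "D2 = K0 \<times> cube (Suc m) \<union> C' \<times> cube_frontier (Suc m)"
  have D2: "closed D2" "D2 \<subseteq> C' \<times> cube (Suc m)"
    using K0 C closedC' closed_cube closed_cube_frontier cube_frontierD
    by (auto simp: D2_def intro!: closed_Un closed_Times)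
  \<comment> \<open>Truncated double speed at \<open>s = 0\<close>, the identity of the cube at
    \<open>s = 1\<close>, and the frontier is mapped into itself for every \<open>s\<close> in
    between.\<close>
  define r where "r = (\<lambda>(p::nat \<Rightarrow> real) s. p(m := min 1 ((2 - s) * p m)))"
  have rng: "min 1 ((2 - s) * u) \<in> {0..1}" if "u \<in> I" "s \<in> I" for u s :: real
    using that by (auto simp: I_def min_def)
  have rcube: "r p s \<in> cube (Suc m)" if "p \<in> cube (Suc m)" "s \<in> I" for p s
    unfolding r_def using rng[OF pm[OF that(1)] that(2)] by (intro cube_upd_same that(1))
  have rfront: "r p s \<in> cube_frontier (Suc m)" if p: "p \<in> cube_frontier (Suc m)" and s: "s \<in> I" for p s
  proof -
    have pc: "p \<in> cube (Suc m)" using p cube_frontierD by blast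
    from p show ?thesis
    proof (cases rule: frontier_cases)
      case 1
      then show ?thesis
        using frontier_upd[OF 1 rng[OF pm[OF pc] s]] by (simp add: r_def)
    next
      case 2
      then show ?thesis using frontier_upd_end[OF cube_upd_zero[OF pc], of 0] by (simp add: r_def)
    next
      case 3
      then have "min 1 ((2 - s) * p m) = 1" using s by (auto simp: I_def)
      then show ?thesis using frontier_upd_end[OF cube_upd_zero[OF pc], of 1] by (simp add: r_def)
    qed
  qed
  define h2 where "h2 = (\<lambda>((y, p), s). if y \<in> K0 then g (y, r p s) else b)"
  have conth2: "continuous_on (D2 \<times> I) h2"
  proof -
    have "continuous_on ((K0 \<times> cube (Suc m)) \<times> I \<union> (C' \<times> cube_frontier (Suc m)) \<times> I)
      (\<lambda>z. if fst (fst z) \<in> K0 then g (fst (fst z), r (snd (fst z)) (snd z)) else b)"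
    proof (rule continuous_on_cases)
      have cm: "continuous_on S (\<lambda>z::('a \<times> (nat \<Rightarrow> real)) \<times> real. snd (fst z) m)" for S
        by (rule continuous_on_product_then_coordinatewise) (intro continuous_on_fst continuous_on_snd continuous_on_id)
      show "continuous_on ((K0 \<times> cube (Suc m)) \<times> I) (\<lambda>z. g (fst (fst z), r (snd (fst z)) (snd z)))"
      proof (rule continuous_on_compose_Pair[OF gD(1)])
        show "continuous_on ((K0 \<times> cube (Suc m)) \<times> I) (\<lambda>z. r (snd (fst z)) (snd z))"
          unfolding r_def
          by (intro continuous_on_upd continuous_on_min continuous_on_mult continuous_on_diff
              continuous_on_const continuous_on_fst continuous_on_snd continuous_on_id cm)
      qed (use K0 rcube in \<open>auto intro!: continuous_on_fst continuous_on_id\<close>)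
    qed (use K0 I closedC' closed_cube closed_cube_frontier gD(3) rfront
        in \<open>auto intro!: closed_Times simp: b_def\<close>)
    moreover have "D2 \<times> I = (K0 \<times> cube (Suc m)) \<times> I \<union> (C' \<times> cube_frontier (Suc m)) \<times> I"
      by (auto simp: D2_def)
    ultimately show ?thesis by (simp add: h2_def case_prod_unfold)
  qed
  obtain g' where g': "continuous_on (C' \<times> cube (Suc m)) g'" "g' ` (C' \<times> cube (Suc m)) \<subseteq> punctured n"
    "\<And>z. z \<in> D2 \<Longrightarrow> g' z = h2 (z, 1)"
  proof (rule homotopic_extendable[where h = h2,
        OF compact_Times[OF C'(1) compact_cube] D2 open_punctured _ _ contG Gim])
    show "continuous_on (D2 \<times> {0..1}) h2" using conth2 by (simp add: I_def)
    show "h2 ` (D2 \<times> {0..1}) \<subseteq> punctured n"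
      using gD(2) K0 bP rcube cube_frontierD by (auto simp: h2_def D2_def I_def)
    show "h2 (z, 0) = G z" if "z \<in> D2" for z
      using that GK0 Gf cube_frontierD by (fastforce simp: h2_def D2_def r_def)
  qed (blast intro: that)
  have r1: "r p 1 = p" if "p \<in> cube (Suc m)" for p
    using pm[OF that] by (auto simp: r_def I_def)
  have "loops n (Suc m) C' g'"
    unfolding loops_def
  proof (intro conjI ballI g')
    fix y q assume "y \<in> C'" "q \<in> cube_frontier (Suc m)"
    then show "g' (y, q) = basepoint n"
      using g'(3)[of "(y, q)"] gD(3) r1[of q] cube_frontierD K0
      by (auto simp: D2_def h2_def b_def)
  qed
  moreover have "g' (y, q) = g (y, q)" if "y \<in> K0" "q \<in> cube (Suc m)" for y q
    using g'(3)[of "(y, q)"] r1[of q] that by (auto simp: D2_def h2_def)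
  ultimately show thesis using that by blast
qed

text \<open>The bound \<open>\<eta>\<close> is given before \<open>\<rho>\<close>: a closed set that
  misses \<open>x\<close> can then be kept off a ball around \<open>x\<close> throughout the
  homotopy.\<close>

definition points_removable :: "'a::metric_space set \<Rightarrow> bool"
  where "points_removable X \<longleftrightarrow> (\<forall>x\<in>X. \<forall>\<eta>>0. \<exists>\<rho>>0. \<exists>\<phi>.
    continuous_on (X \<times> {0..1::real}) \<phi> \<and> \<phi> ` (X \<times> {0..1}) \<subseteq> X \<and>
    (\<forall>y\<in>X. \<phi> (y, 0) = y \<and> \<rho> \<le> dist x (\<phi> (y, 1)) \<and> (\<forall>t\<in>{0..1}. dist y (\<phi> (y, t)) \<le> \<eta>)))"

text \<open>\<open>punctured n\<close> is open, so a Tietze extension still takes values in it over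
  a neighbourhood \<open>K1\<close> of \<open>K0\<close>. The remainder \<open>K2\<close> is compact
  and misses \<open>K0\<close>, ready to be covered by balls.\<close>

lemma loops_extend_near:
  fixes K :: "'a::metric_space set"
  assumes K: "compact K" and K0: "closed K0" "K0 \<subseteq> K" and f: "loops n m K0 f"
  obtains K1 K2 g where "closed K1" "K0 \<subseteq> K1" "K1 \<subseteq> K" "compact K2" "K0 \<inter> K2 = {}" "K = K1 \<union> K2"
    "loops n m K1 g" "\<And>x q. x \<in> K0 \<Longrightarrow> q \<in> cube m \<Longrightarrow> g (x, q) = f (x, q)"
proof -
  note fD = loopsD[OF f]
  have cK: "closed K" using K compact_imp_closed by blast
  define D where "D = K0 \<times> cube m \<union> K \<times> cube_frontier m"
  have D: "closed D" "D \<subseteq> K \<times> cube m"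
    using K0 cK closed_cube closed_cube_frontier cube_frontierD
    by (auto simp: D_def intro!: closed_Un closed_Times)
  define F where "F = (\<lambda>z. if fst z \<in> K0 then f (fst z, snd z) else basepoint n)"
  have "continuous_on D F"
    unfolding F_def D_def
  proof (rule continuous_on_cases)
    show "continuous_on (K0 \<times> cube m) (\<lambda>z. f (fst z, snd z))"
      unfolding prod.collapse by (rule fD(1))
  qed (use K0 cK closed_cube closed_cube_frontier fD(3) in \<open>auto intro!: closed_Times\<close>)
  then obtain G where G: "continuous_on (K \<times> cube m) G" "\<And>z. z \<in> D \<Longrightarrow> G z = F z"
    using Tietze_fun[OF D] by metis
  define B where "B = fst ` ((K \<times> cube m) \<inter> G -` (- punctured n))"
  have "closedin (top_of_set (K \<times> cube m)) ((K \<times> cube m) \<inter> G -` (- punctured n))"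
    using G(1) open_punctured by (intro continuous_closedin_preimage) auto
  then have "compact ((K \<times> cube m) \<inter> G -` (- punctured n))"
    by (rule closedin_compact[rotated]) (simp add: K compact_Times compact_cube)
  then have B: "closed B"
    unfolding B_def by (intro compact_imp_closed compact_continuous_image continuous_intros)
  have GB: "G (x, q) \<in> punctured n" if "x \<in> K" "q \<in> cube m" "x \<notin> B" for x q
  proof (rule ccontr)
    assume "G (x, q) \<notin> punctured n"
    then have "(x, q) \<in> (K \<times> cube m) \<inter> G -` (- punctured n)" using that by auto
    then show False using that(3) unfolding B_def by (metis fst_conv imageI)
  qed
  have GK0: "G (x, q) = f (x, q)" if "x \<in> K0" "q \<in> cube m" for x q
    using G(2)[of "(x, q)"] that by (simp add: D_def F_def)
  have "K0 \<inter> B = {}"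
    using fD(2) GK0 by (auto simp: B_def) 
  then obtain u :: "'a \<Rightarrow> real" where u: "continuous_on UNIV u" "\<And>x. u x \<in> {0..1}"
    "\<And>x. x \<in> K0 \<Longrightarrow> u x = 0" "\<And>x. x \<in> B \<Longrightarrow> u x = 1"
    using Urysohn_metric[OF K0(1) B] by metis
  \<comment> \<open>Cutting at \<open>1/2\<close> keeps \<open>K1\<close> away from
    \<open>B\<close>, where \<open>u\<close> is \<open>1\<close>, and \<open>K2\<close> away from
    \<open>K0\<close>, where \<open>u\<close> is \<open>0\<close>.\<close>
  define K1 where "K1 = K \<inter> u -` {..1/2}"
  define K2 where "K2 = K \<inter> u -` {1/2..}"
  have uK: "continuous_on K u" using u(1) continuous_on_subset by blast
  have K1: "closed K1" unfolding K1_def by (rule continuous_closed_preimage[OF uK cK closed_atMost])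
  have "closed K2" unfolding K2_def by (rule continuous_closed_preimage[OF uK cK closed_atLeast])
  then have "compact K2" using K compact_Int_closed[of K K2] by (auto simp: K2_def Int_absorb1)
  moreover have "K0 \<subseteq> K1" "K1 \<subseteq> K" "K0 \<inter> K2 = {}" "K = K1 \<union> K2"
    using K0 u(3) by (auto simp: K1_def K2_def)
  moreover have "loops n m K1 G"
    unfolding loops_def
  proof (intro conjI ballI)
    show "continuous_on (K1 \<times> cube m) G"
      by (rule continuous_on_subset[OF G(1)]) (auto simp: K1_def)
    have "x \<notin> B" if "x \<in> K1" for x using u(4)[of x] that by (auto simp: K1_def)
    then show "G ` (K1 \<times> cube m) \<subseteq> punctured n" using GB by (auto simp: K1_def)
    show "G (x, q) = basepoint n" if "x \<in> K1" "q \<in> cube_frontier m" for x q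
      using G(2)[of "(x, q)"] that fD(3) by (auto simp: D_def F_def K1_def)
  qed
  ultimately show thesis using that K1 GK0 by blast
qed

text \<open>After an extension to a neighbourhood of \<open>K0\<close>, the compact remainder is
  covered by finitely many balls, each small enough for \<open>K0\<close> to stay off it, and these
  are filled in one at a time by \<open>loops_extend_ball\<close>.\<close>

lemma loops_extend_Suc:
  fixes X :: "'a::metric_space set"
  assumes X: "points_removable X" and ext: "loops_extend n m X"
  shows "loops_extend n (Suc m) X"
  unfolding loops_extend_def
proof (intro allI impI, elim conjE)
  fix K K0 :: "'a set" and f
  assume K: "compact K" "K \<subseteq> X" and K0: "closed K0" "K0 \<subseteq> K" and f: "loops n (Suc m) K0 f"
  obtain K1 K2 g1 where K1: "closed K1" "K0 \<subseteq> K1" "K1 \<subseteq> K" "compact K2" "K0 \<inter> K2 = {}" "K = K1 \<union> K2"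
    "loops n (Suc m) K1 g1" "\<And>x q. x \<in> K0 \<Longrightarrow> q \<in> cube (Suc m) \<Longrightarrow> g1 (x, q) = f (x, q)"
    using loops_extend_near[OF K(1) K0 f] by metis
  define P where "P = (\<lambda>x \<rho> \<phi>. \<rho> > 0 \<and> continuous_on (X \<times> {0..1::real}) \<phi> \<and> \<phi> ` (X \<times> {0..1}) \<subseteq> X \<and>
    (\<forall>y\<in>X. \<phi> (y, 0) = y \<and> \<rho> \<le> dist x (\<phi> (y, 1))) \<and> (\<forall>y\<in>K0. \<forall>t\<in>{0..1}. \<rho> \<le> dist x (\<phi> (y, t))))"
  have "\<exists>\<rho> \<phi>. P x \<rho> \<phi>"
    if x: "x \<in> K2" for x
  proof -
    have "x \<notin> K0" "x \<in> X" using x K1 K by auto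
    then obtain e where e: "e > 0" "ball x e \<subseteq> - K0"
      using K0(1) by (metis ComplI open_Compl open_contains_ball)
    then obtain \<rho> \<phi> where \<phi>: "\<rho> > 0" "continuous_on (X \<times> {0..1::real}) \<phi>" "\<phi> ` (X \<times> {0..1}) \<subseteq> X"
      "\<And>y. y \<in> X \<Longrightarrow> \<phi> (y, 0) = y \<and> \<rho> \<le> dist x (\<phi> (y, 1)) \<and> (\<forall>t\<in>{0..1}. dist y (\<phi> (y, t)) \<le> e / 2)"
      using X[unfolded points_removable_def, THEN bspec, OF \<open>x \<in> X\<close>, THEN spec, of "e / 2"] by auto
    \<comment> \<open>Points of \<open>K0\<close> have distance at least \<open>e\<close> from
      \<open>x\<close> and move by at most \<open>e / 2\<close>.\<close>
    have "min \<rho> (e / 2) \<le> dist x (\<phi> (y, t))" if "y \<in> K0" "t \<in> {0..1}" for y t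
    proof -
      have "e \<le> dist x y" using e(2) that by (auto simp: subset_iff not_less)
      moreover have "dist y (\<phi> (y, t)) \<le> e / 2" using \<phi>(4) that K0 K by blast
      ultimately have "e / 2 \<le> dist x (\<phi> (y, t))" using dist_triangle[of x y "\<phi> (y, t)"] by (simp add: dist_commute)
      then show ?thesis by simp
    qed
    moreover have "min \<rho> (e / 2) > 0" using \<phi>(1) e(1) by simp
    moreover have "\<phi> (y, 0) = y \<and> min \<rho> (e / 2) \<le> dist x (\<phi> (y, 1))" if "y \<in> X" for y
      using \<phi>(4)[OF that] by auto
    ultimately have "P x (min \<rho> (e / 2)) \<phi>" using \<phi>(2,3) unfolding P_def by simp
    then show ?thesis by blast
  qed
  then obtain \<rho> \<phi> where P: "\<And>x. x \<in> K2 \<Longrightarrow> P x (\<rho> x) (\<phi> x)"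
    by metis
  note \<phi> = P[unfolded P_def]
  \<comment> \<open>Half the radius, so that the closed balls added below lie inside the open balls
    of radius \<open>\<rho> x\<close> and the domain stays closed.\<close>
  define b where "b = (\<lambda>x. ball x (\<rho> x / 2))"
  have "x \<in> b x" if "x \<in> K2" for x using \<phi>[OF that] by (simp add: b_def)
  then have cov: "K2 \<subseteq> \<Union>(b ` K2)" by auto
  obtain T where T: "finite T" "T \<subseteq> K2" "K2 \<subseteq> \<Union>(b ` T)"
  proof (rule compactE_image[OF K1(4), of K2 b])
    show "open (b x)" for x by (simp add: b_def)
    show "K2 \<subseteq> \<Union>(b ` K2)" by (rule cov)
  qed (blast intro: that)
  \<comment> \<open>Only the values on \<open>K0\<close> are carried through the induction;
    elsewhere the map may change when a ball is added.\<close>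
  have "\<exists>g. loops n (Suc m) (K1 \<union> (K \<inter> (\<Union>x\<in>S. cball x (\<rho> x / 2)))) g \<and>
      (\<forall>x\<in>K0. \<forall>q\<in>cube (Suc m). g (x, q) = f (x, q))" if "finite S" "S \<subseteq> K2" for S
    using that
  proof (induction S)
    case empty
    then show ?case using K1(7,8) by auto
  next
    case (insert x S)
    define C where "C = K1 \<union> (K \<inter> (\<Union>x\<in>S. cball x (\<rho> x / 2)))"
    define C' where "C' = C \<union> (K \<inter> cball x (\<rho> x / 2))"
    have cK: "closed K" using K compact_imp_closed by blast
    obtain g where g: "loops n (Suc m) C g" "\<And>x q. x \<in> K0 \<Longrightarrow> q \<in> cube (Suc m) \<Longrightarrow> g (x, q) = f (x, q)"
      using insert C_def by auto
    have C: "closed C" unfolding C_def using insert(1) cK K1(1)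
      by (intro closed_Un closed_Int closed_UN) auto
    have "closed C'" unfolding C'_def using C cK by auto
    then have C': "compact C'" "C' \<subseteq> K"
      using K(1) compact_Int_closed[of K C'] K1(3) by (auto simp: C'_def C_def Int_absorb1)
    have x: "x \<in> K2" using insert by auto
    note \<phi>x = \<phi>[OF x]
    have "\<rho> x > 0" using \<phi>x by simp
    then have "cball x (\<rho> x / 2) \<subseteq> ball x (\<rho> x)" by auto
    then have sub: "C' - ball x (\<rho> x) \<subseteq> C" by (auto simp: C'_def)
    obtain g' where "loops n (Suc m) C' g'"
      "\<And>y q. y \<in> K0 \<Longrightarrow> q \<in> cube (Suc m) \<Longrightarrow> g' (y, q) = g (y, q)"
    proof (rule loops_extend_ball[OF ext C'(1) _ C _ sub K0(1) _ g(1), of "\<phi> x"])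
      show "C' \<subseteq> X" using C' K by auto
      show "C \<subseteq> C'" by (simp add: C'_def)
      show "K0 \<subseteq> C" using K1(2) by (auto simp: C_def)
    qed (use \<phi>x in \<open>blast intro: that\<close>)+
    moreover have "C' = K1 \<union> (K \<inter> (\<Union>x\<in>insert x S. cball x (\<rho> x / 2)))"
      by (auto simp: C'_def C_def)
    ultimately show ?case using g(2) by auto
  qed
  from this[OF T(1,2)] obtain g where g: "loops n (Suc m) (K1 \<union> (K \<inter> (\<Union>x\<in>T. cball x (\<rho> x / 2)))) g"
    "\<forall>x\<in>K0. \<forall>q\<in>cube (Suc m). g (x, q) = f (x, q)" by blast
  have "K2 \<subseteq> (\<Union>x\<in>T. cball x (\<rho> x / 2))"
    by (rule order_trans[OF T(3) UN_mono[OF subset_refl]]) (simp add: b_def ball_subset_cball)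
  then have "K1 \<union> (K \<inter> (\<Union>x\<in>T. cball x (\<rho> x / 2))) = K" using K1(3,6) by blast
  then show "\<exists>g. loops n (Suc m) K g \<and> (\<forall>x\<in>K0. \<forall>q\<in>cube (Suc m). g (x, q) = f (x, q))"
    using g by auto
qed

section \<open>The base case and the contradiction\<close>

lemma cube_0: "cube 0 = {\<lambda>_. 0}"
  by (auto simp: cube_def)

text \<open>\<open>cube 0\<close> is a point with empty frontier, so this is extension of plain maps
  into \<open>punctured n\<close>, where ply \<open>n + 1\<close> means dimension at most
  \<open>n\<close>.\<close>

lemma loops_extend_0:
  assumes "\<And>K. compact K \<Longrightarrow> K \<subseteq> X \<Longrightarrow> refinable_to_ply (top_of_set K) (Suc n)"
  shows "loops_extend n 0 X"
  unfolding loops_extend_def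
proof (intro allI impI, elim conjE)
  fix K K0 f
  assume K: "compact K" "K \<subseteq> X" and K0: "closed K0" "K0 \<subseteq> K" and f: "loops n 0 K0 f"
  have "continuous_on K0 (\<lambda>x. f (x, \<lambda>_. 0))"
    by (rule continuous_on_compose_Pair[OF loopsD(1)[OF f]])
      (auto simp: cube_0 intro: continuous_on_id continuous_on_const)
  moreover have "(\<lambda>x. f (x, \<lambda>_. 0)) ` K0 \<subseteq> punctured n"
    using loopsD(2)[OF f] by (auto simp: cube_0)
  ultimately obtain g where g: "continuous_on K g" "g ` K \<subseteq> punctured n"
    "\<And>x. x \<in> K0 \<Longrightarrow> g x = f (x, \<lambda>_. 0)"
    using extend_to_punctured[OF K(1) assms[OF K] K0] by metis
  have "continuous_on (K \<times> cube 0) (\<lambda>z. g (fst z))"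
    by (rule continuous_on_compose2[OF g(1) continuous_on_fst[OF continuous_on_id]]) auto
  then have "loops n 0 K (\<lambda>z. g (fst z))"
    using g(2) by (auto simp: loops_def cube_frontier_def)
  then show "\<exists>g. loops n 0 K g \<and> (\<forall>x\<in>K0. \<forall>q\<in>cube 0. g (x, q) = f (x, q))"
    using g(3) by (intro exI[of _ "\<lambda>z. g (fst z)"]) (auto simp: cube_0)
qed

text \<open>A path in \<open>X\<close> would be a null-homotopy of \<open>wrap n\<close> if the family with value
  \<open>wrap n\<close> at one end and the constant one at the other could be extended along it.\<close>

lemma not_loops_extend:
  fixes X :: "'a::metric_space set"
  assumes c: "continuous_on {0..1::real} c" "c ` {0..1} \<subseteq> X" "c 0 \<noteq> c 1"
  shows "\<not> loops_extend n n X"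
proof
  assume ext: "loops_extend n n X"
  define K where "K = c ` {0..1}"
  define K0 where "K0 = {c 0, c 1}"
  have K: "compact K" "K \<subseteq> X" using c by (auto simp: K_def intro: compact_continuous_image)
  have K0: "closed K0" "K0 \<subseteq> K" by (auto simp: K0_def K_def)
  define f where "f = (\<lambda>z. if fst z \<in> {c 0} then wrap n (snd z) else basepoint n)"
  have "continuous_on ({c 0} \<times> cube n \<union> {c 1} \<times> cube n) f"
    unfolding f_def
  proof (rule continuous_on_cases)
    show "continuous_on ({c 0} \<times> cube n) (\<lambda>z. wrap n (snd z))"
      by (rule continuous_on_compose2[OF continuous_on_wrap[of UNIV] continuous_on_snd[OF continuous_on_id]]) auto
  qed (use c(3) closed_cube in \<open>auto intro!: closed_Times\<close>)
  moreover have "{c 0} \<times> cube n \<union> {c 1} \<times> cube n = K0 \<times> cube n" by (auto simp: K0_def)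
  ultimately have f: "loops n n K0 f"
    using wrap_punctured basepoint_punctured wrap_frontier by (auto simp: loops_def f_def)
  have "\<exists>g. loops n n K g \<and> (\<forall>x\<in>K0. \<forall>q\<in>cube n. g (x, q) = f (x, q))"
    by (rule ext[unfolded loops_extend_def, THEN spec, THEN spec, THEN spec, THEN mp])
      (simp add: f K K0)
  then obtain g where g: "loops n n K g" "\<And>x q. x \<in> K0 \<Longrightarrow> q \<in> cube n \<Longrightarrow> g (x, q) = f (x, q)"
    by metis
  have cK: "c t \<in> K" if "t \<in> {0..1}" for t using that by (simp add: K_def)
  show False
  proof (rule wrap_essential)
    show "continuous_on (cube n \<times> {0..1}) (\<lambda>z. g (c (snd z), fst z))"
      by (rule continuous_on_compose_Pair[OF loopsD(1)[OF g(1)]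
            continuous_on_compose2[OF c(1) continuous_on_snd[OF continuous_on_id]]])
        (use cK in \<open>auto intro: continuous_on_fst continuous_on_id\<close>)
    show "(\<lambda>z. g (c (snd z), fst z)) ` (cube n \<times> {0..1}) \<subseteq> punctured n"
      using loopsD(2)[OF g(1)] cK by auto
    show "g (c (snd (q, 0)), fst (q, 0)) = wrap n q" if "q \<in> cube n" for q
      using g(2)[of "c 0" q] that by (simp add: K0_def f_def)
    show "g (c (snd (q, 1)), fst (q, 1)) = basepoint n" if "q \<in> cube n" for q
      using g(2)[of "c 1" q] that c(3) by (simp add: K0_def f_def)
    show "g (c (snd (q, t)), fst (q, t)) = basepoint n" if "q \<in> cube_frontier n" "t \<in> {0..1}" for q t
      using loopsD(3)[OF g(1) cK[OF that(2)] that(1)] by simp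
  qed
qed

text \<open>If all compact subsets had dimension at most \<open>n\<close>, the extension property
  would hold for \<open>0\<close>-fold loops, hence by induction for \<open>n\<close>-fold loops,
  which the path excludes.\<close>

lemma points_removable_infinite_dimensional:
  fixes X :: "'a::metric_space set"
  assumes "points_removable X" "continuous_on {0..1::real} c" "c ` {0..1} \<subseteq> X" "c 0 \<noteq> c 1"
  obtains K where "compact K" "K \<subseteq> X" "\<not> refinable_to_ply (top_of_set K) (Suc n)"
proof -
  have "loops_extend n m X" if "loops_extend n 0 X" for m
    by (induction m) (use that loops_extend_Suc[OF assms(1)] in auto)
  then show thesis using loops_extend_0[of X n] not_loops_extend[OF assms(2-4)] that by blast
qed

subsection \<open>Comparison with the sphere\<close>

text \<open>The left side is the squared length of
  \<open>sin a *\<^sub>R u + sin s *\<^sub>R v\<close> for unit vectors \<open>u\<close>,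
  \<open>v\<close> at angle \<open>a + s\<close>.\<close>

lemma sin_add_square:
  fixes a s :: real
  shows "(sin a)\<^sup>2 + 2 * sin a * sin s * cos (a + s) + (sin s)\<^sup>2 = (sin (a + s))\<^sup>2"
  using sin_cos_squared_add[of a] sin_cos_squared_add[of s] unfolding sin_add cos_add by algebra

text \<open>Spherical interpolation, multiplied by \<open>sin L\<close> to avoid division. Both
  sides have squared length and mutual inner product \<open>(sin L)\<^sup>2\<close>, so their
  difference has length zero.\<close>

lemma great_circle_point:
  fixes u v p :: "'v::real_inner"
  assumes "norm u = 1" "norm v = 1" "norm p = 1"
    and uv: "u \<bullet> v = cos L" and up: "u \<bullet> p = cos s" and pv: "p \<bullet> v = cos (L - s)"
  shows "sin L *\<^sub>R p = sin (L - s) *\<^sub>R u + sin s *\<^sub>R v"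
proof -
  have n: "u \<bullet> u = 1" "v \<bullet> v = 1" "p \<bullet> p = 1" using assms by (simp_all add: dot_square_norm)
  define q where "q = sin (L - s) *\<^sub>R u + sin s *\<^sub>R v"
  have "p \<bullet> q = sin (L - s) * cos s + sin s * cos (L - s)"
    using up pv by (simp add: q_def inner_add_right inner_commute)
  also have "\<dots> = sin L" using sin_add[of "L - s" s] by (simp add: mult.commute)
  finally have pq: "p \<bullet> q = sin L" .
  have "q \<bullet> q = (sin (L - s))\<^sup>2 + 2 * sin (L - s) * sin s * cos L + (sin s)\<^sup>2"
    by (simp add: q_def inner_add_right inner_add_left n uv inner_commute[of v u] power2_eq_square algebra_simps)
  also have "\<dots> = (sin L)\<^sup>2" using sin_add_square[of "L - s" s] by simp
  finally have qq: "q \<bullet> q = (sin L)\<^sup>2" .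
  have "(sin L *\<^sub>R p - q) \<bullet> (sin L *\<^sub>R p - q) = 0"
    by (simp add: inner_diff_left inner_diff_right n pq inner_commute[of q p] qq power2_eq_square)
  then show ?thesis by (simp add: q_def)
qed

lemma S2_inner:
  assumes "u \<in> S2" "v \<in> S2"
  shows "norm u = 1" "u \<bullet> v \<in> {-1..1}" "u \<bullet> v = cos (S2_dist u v)"
proof -
  have n: "norm u = 1" "norm v = 1" using assms by (auto simp: S2_def)
  then show "norm u = 1" by simp
  have "\<bar>u \<bullet> v\<bar> \<le> 1" using Cauchy_Schwarz_ineq2[of u v] n by simp
  then show "u \<bullet> v \<in> {-1..1}" "u \<bullet> v = cos (S2_dist u v)"
    by (auto simp: S2_dist_def abs_le_iff)
qed

lemma less_3_iff: "(\<forall>i<3. P i) \<longleftrightarrow> P 0 \<and> P (Suc 0) \<and> P 2"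
proof -
  have "{i::nat. i < 3} = {0, Suc 0, 2}" by auto
  then show ?thesis by (metis (mono_tags) insertE insertI1 insertI2 mem_Collect_eq singletonD)
qed

text \<open>The cosine of the distance in \<open>S2\<close> between the points at distance \<open>s\<close> and \<open>s'\<close> from
  the first ends of two sides of lengths \<open>L\<close> and \<open>L'\<close> that meet at their second ends and
  whose first ends have distance \<open>e\<close>.\<close>

definition side_cos :: "real \<Rightarrow> real \<Rightarrow> real \<Rightarrow> real \<Rightarrow> real \<Rightarrow> real"
  where "side_cos L s L' s' e = (sin (L - s) * sin (L' - s') * cos e + sin (L - s) * sin s' * cos L
    + sin s * sin (L' - s') * cos L' + sin s * sin s') / (sin L * sin L')"

lemma side_cos_refl:
  assumes "sin L \<noteq> 0"
  shows "side_cos L s L s 0 = 1"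
proof -
  have "sin (L - s) * sin (L - s) * cos 0 + sin (L - s) * sin s * cos L
    + sin s * sin (L - s) * cos L + sin s * sin s = sin L * sin L"
    using sin_add_square[of "L - s" s] by (simp add: power2_eq_square algebra_simps)
  then show ?thesis using assms by (simp add: side_cos_def)
qed

lemma tendsto_side_cos:
  fixes F :: "'b::t2_space filter"
  assumes "(f \<longlongrightarrow> L') F" "(g \<longlongrightarrow> s') F" "(h \<longlongrightarrow> e) F" "sin L \<noteq> 0" "sin L' \<noteq> 0"
  shows "((\<lambda>x. side_cos L s (f x) (g x) (h x)) \<longlongrightarrow> side_cos L s L' s' e) F"
  unfolding side_cos_def
  by (intro tendsto_divide tendsto_add tendsto_mult tendsto_sin tendsto_cos tendsto_diff
      tendsto_const assms(1-3)) (use assms in simp)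

lemma geodesic_dist:
  "geodesic M d x y \<gamma> \<Longrightarrow> s \<in> {0..d x y} \<Longrightarrow> t \<in> {0..d x y} \<Longrightarrow> d (\<gamma> s) (\<gamma> t) = \<bar>s - t\<bar>"
  by (simp add: geodesic_def)

text \<open>In the comparison triangle both points are combinations of the vertices by
  \<open>great_circle_point\<close>, and their inner product is \<open>side_cos\<close>. Being such
  a product, it lies in the domain of \<open>arccos\<close>.\<close>

lemma CAT1_sides:
  assumes X: "CAT1 X" and \<gamma>: "geodesic X dist y z \<gamma>" and \<gamma>': "geodesic X dist y' z \<gamma>'"
    and pos: "0 < dist y z" "dist y z < pi" "0 < dist y' z" "dist y' z < pi"
    and per: "dist y' y < pi" "dist y z + dist y' z + dist y' y < 2 * pi"
    and s: "s \<in> {0..dist y z}" and s': "s' \<in> {0..dist y' z}"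
  shows "side_cos (dist y z) s (dist y' z) s' (dist y' y) \<in> {-1..1}"
    "dist (\<gamma> s) (\<gamma>' s') \<le> arccos (side_cos (dist y z) s (dist y' z) s' (dist y' y))"
proof -
  define L where "L = dist y z"
  define L' where "L' = dist y' z"
  note geo = geodesic_def
  have inX: "y \<in> X" "y' \<in> X" using \<gamma> \<gamma>' by (auto simp: geo)
  obtain \<beta> where \<beta>: "geodesic X dist y' y \<beta>"
    using X inX per(1) unfolding CAT1_def by blast
  \<comment> \<open>Sides run cyclically, so \<open>\<gamma>'\<close> is traversed backwards and its
    parameter becomes \<open>L' - s'\<close>.\<close>
  have rev: "geodesic X dist z y' (\<lambda>t. \<gamma>' (L' - t))"
  proof -
    have "dist z y' = L'" by (simp add: L'_def dist_commute)
    then show ?thesis using \<gamma>' unfolding geo by (auto simp: L'_def image_subset_iff dist_commute)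
  qed
  define v where "v = (\<lambda>i::nat. if i = 0 then y else if i = Suc 0 then z else y')"
  define g where "g = (\<lambda>i::nat. if i = 0 then \<gamma> else if i = Suc 0 then (\<lambda>t. \<gamma>' (L' - t)) else \<beta>)"
  have m: "Suc 0 mod 3 = Suc 0" "Suc (Suc 0) mod 3 = 2" "Suc 2 mod 3 = 0" by simp_all
  have v: "v 0 = y" "v (Suc 0) = z" "v 2 = y'" and g: "g 0 = \<gamma>" "g (Suc 0) = (\<lambda>t. \<gamma>' (L' - t))" "g 2 = \<beta>"
    by (simp_all add: v_def g_def)
  have "geodesic_triangle X dist v g"
    unfolding geodesic_triangle_def less_3_iff m v g using \<gamma> rev \<beta> by simp
  moreover have "perimeter dist v < 2 * pi"
  proof -
    have three: "{..<3::nat} = {0, Suc 0, 2}" by auto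
    have "perimeter dist v = dist y z + dist z y' + dist y' y"
      unfolding perimeter_def three by (simp add: v_def)
    then show ?thesis using per(2) by (simp add: dist_commute)
  qed
  ultimately obtain w c where wc: "comparison_triangle v w c"
    "\<forall>i<3. \<forall>j<3. \<forall>s\<in>{0..dist (v i) (v (Suc i mod 3))}. \<forall>t\<in>{0..dist (v j) (v (Suc j mod 3))}.
            dist (g i s) (g j t) \<le> S2_dist (c i s) (c j t)"
    using X unfolding CAT1_def by blast
  have zy': "dist z y' = L'" by (simp add: L'_def dist_commute)
  have sides: "S2_dist (w 0) (w (Suc 0)) = L" "S2_dist (w (Suc 0)) (w 2) = L'" "S2_dist (w 2) (w 0) = dist y' y"
    and geos: "geodesic S2 S2_dist (w 0) (w (Suc 0)) (c 0)" "geodesic S2 S2_dist (w (Suc 0)) (w 2) (c (Suc 0))"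
    using wc(1) unfolding comparison_triangle_def geodesic_triangle_def less_3_iff m v
    by (simp_all add: L_def zy')
  have le: "dist (\<gamma> s) (\<gamma>' s') \<le> S2_dist (c 0 s) (c (Suc 0) (L' - s'))"
  proof -
    have "dist (g 0 s) (g (Suc 0) (L' - s')) \<le> S2_dist (c 0 s) (c (Suc 0) (L' - s'))"
      using wc(2)[unfolded less_3_iff m v] s s' by (simp add: zy' L'_def)
    then show ?thesis unfolding g by simp
  qed
  have s1: "s \<in> {0..S2_dist (w 0) (w (Suc 0))}" "0 \<in> {0..S2_dist (w 0) (w (Suc 0))}" "L \<in> {0..S2_dist (w 0) (w (Suc 0))}"
    using s pos by (auto simp: sides L_def)
  have s2: "L' - s' \<in> {0..S2_dist (w (Suc 0)) (w 2)}" "0 \<in> {0..S2_dist (w (Suc 0)) (w 2)}" "L' \<in> {0..S2_dist (w (Suc 0)) (w 2)}"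
    using s' pos by (auto simp: sides L'_def)
  have inS: "w 0 \<in> S2" "w (Suc 0) \<in> S2" "w 2 \<in> S2" "c 0 s \<in> S2" "c (Suc 0) (L' - s') \<in> S2"
    using geos s1 s2 by (auto simp: geo)
  have ends: "c 0 0 = w 0" "c 0 L = w (Suc 0)" "c (Suc 0) 0 = w (Suc 0)" "c (Suc 0) L' = w 2"
    using geos sides by (auto simp: geo)
  have "S2_dist (c 0 0) (c 0 s) = s" "S2_dist (c 0 s) (c 0 L) = L - s"
    "S2_dist (c (Suc 0) 0) (c (Suc 0) (L' - s')) = L' - s'" "S2_dist (c (Suc 0) (L' - s')) (c (Suc 0) L') = s'"
    using geodesic_dist[OF geos(1) s1(2,1)] geodesic_dist[OF geos(1) s1(1,3)]
      geodesic_dist[OF geos(2) s2(2,1)] geodesic_dist[OF geos(2) s2(1,3)] s s'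
    by (simp_all add: L_def L'_def)
  then have i1: "w 0 \<bullet> c 0 s = cos s" "c 0 s \<bullet> w (Suc 0) = cos (L - s)"
    and i2: "w (Suc 0) \<bullet> c (Suc 0) (L' - s') = cos (L' - s')" "c (Suc 0) (L' - s') \<bullet> w 2 = cos (L' - (L' - s'))"
    using S2_inner(3) inS by (simp_all add: ends)
  have i3: "w 0 \<bullet> w (Suc 0) = cos L" "w (Suc 0) \<bullet> w 2 = cos L'" "w 2 \<bullet> w 0 = cos (dist y' y)"
    using S2_inner(3) inS sides by auto
  have nrm: "norm (w 0) = 1" "norm (w (Suc 0)) = 1" "norm (w 2) = 1" "norm (c 0 s) = 1" "norm (c (Suc 0) (L' - s')) = 1"
    using S2_inner(1) inS by auto
  have p: "sin L *\<^sub>R c 0 s = sin (L - s) *\<^sub>R w 0 + sin s *\<^sub>R w (Suc 0)"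
    by (rule great_circle_point) (use nrm i1 i3 in auto)
  have p': "sin L' *\<^sub>R c (Suc 0) (L' - s') = sin (L' - (L' - s')) *\<^sub>R w (Suc 0) + sin (L' - s') *\<^sub>R w 2"
    by (rule great_circle_point) (use nrm i2 i3 in auto)
  have ww: "w (Suc 0) \<bullet> w (Suc 0) = 1" using nrm by (simp add: dot_square_norm)
  have "sin L * sin L' * (c 0 s \<bullet> c (Suc 0) (L' - s')) = (sin L *\<^sub>R c 0 s) \<bullet> (sin L' *\<^sub>R c (Suc 0) (L' - s'))"
    by simp
  also have "\<dots> = sin (L - s) * sin (L' - s') * cos (dist y' y) + sin (L - s) * sin s' * cos L
    + sin s * sin (L' - s') * cos L' + sin s * sin s'"
    unfolding p p' using i3 ww
    by (simp add: inner_add_left inner_add_right inner_commute[of "w 0" "w 2"] algebra_simps)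
  finally have "c 0 s \<bullet> c (Suc 0) (L' - s') = side_cos L s L' s' (dist y' y)"
    using pos sin_gt_zero[of L] sin_gt_zero[of L'] by (simp add: side_cos_def field_simps L_def L'_def)
  then show "side_cos (dist y z) s (dist y' z) s' (dist y' y) \<in> {-1..1}"
    "dist (\<gamma> s) (\<gamma>' s') \<le> arccos (side_cos (dist y z) s (dist y' z) s' (dist y' y))"
    using le S2_inner(2)[OF inS(4,5)] by (simp_all add: S2_dist_def L_def L'_def)
qed

section \<open>Contraction towards a point along geodesics\<close>

text \<open>Two geodesics to \<open>z\<close> from nearby starting points are compared on the
  sphere: the cosine bounding the distance of their points tends to \<open>1\<close> as starting
  points and times merge.\<close>

lemma CAT1_flow_continuous:
  fixes X :: "'a::metric_space set"
  assumes X: "CAT1 X" and z: "z \<in> X" and r: "\<And>y. y \<in> X \<Longrightarrow> dist y z \<le> r" "r < pi"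
    and \<gamma>: "\<And>y. y \<in> X \<Longrightarrow> geodesic X dist y z (\<gamma> y)" and "\<delta> \<ge> 0"
  shows "continuous_on (X \<times> {0..1}) (\<lambda>p. \<gamma> (fst p) (min (\<delta> * snd p) (dist (fst p) z)))"
    (is "continuous_on ?S ?\<phi>")
  unfolding continuous_on_def
proof
  fix p assume p: "p \<in> ?S"
  obtain y t where yt: "p = (y, t)" "y \<in> X" "t \<in> {0..1}" using p by auto
  let ?F = "at p within ?S"
  have par: "min (\<delta> * snd q) (dist (fst q) z) \<in> {0..dist (fst q) z}" if "q \<in> ?S" for q
    using that \<open>\<delta> \<ge> 0\<close> by (auto simp: min_def)
  have inS: "\<forall>\<^sub>F q in ?F. q \<in> ?S" by (simp add: eventually_at_filter)
  have fst: "(fst \<longlongrightarrow> y) ?F" and snd: "(snd \<longlongrightarrow> t) ?F"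
    using tendsto_fst[OF tendsto_ident_at[of p ?S]] tendsto_snd[OF tendsto_ident_at[of p ?S]] yt by auto
  have L': "((\<lambda>q. dist (fst q) z) \<longlongrightarrow> dist y z) ?F" by (intro tendsto_intros fst)
  have "((\<lambda>q. dist (?\<phi> q) (?\<phi> p)) \<longlongrightarrow> 0) ?F"
  \<comment> \<open>Here the comparison formula would divide by \<open>sin 0\<close>; instead,
    moving along a geodesic to \<open>z\<close> does not increase the distance to
    \<open>z\<close>.\<close>
  proof (cases "y = z")
    case True
    have pz: "?\<phi> p = z" using \<gamma>[OF z] \<open>\<delta> \<ge> 0\<close> yt True by (auto simp: geodesic_def)
    have "\<forall>\<^sub>F q in ?F. norm (dist (?\<phi> q) z) \<le> dist (fst q) z"
      using inS
    proof eventually_elim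
      case (elim q)
      then have g: "geodesic X dist (fst q) z (\<gamma> (fst q))" using \<gamma> by auto
      have "dist (?\<phi> q) (\<gamma> (fst q) (dist (fst q) z)) = \<bar>min (\<delta> * snd q) (dist (fst q) z) - dist (fst q) z\<bar>"
        using g par[OF elim] unfolding geodesic_def by (metis atLeastAtMost_iff order_refl zero_le_dist)
      moreover have "\<gamma> (fst q) (dist (fst q) z) = z" using g by (simp add: geodesic_def)
      ultimately show ?case using par[OF elim] by auto
    qed
    moreover have "((\<lambda>q. dist (fst q) z) \<longlongrightarrow> 0) ?F" using L' True by simp
    ultimately show ?thesis unfolding pz by (rule Lim_null_comparison)
  next
    case False
    let ?s = "min (\<delta> * t) (dist y z)"
    let ?\<theta> = "\<lambda>q. side_cos (dist y z) ?s (dist (fst q) z) (min (\<delta> * snd q) (dist (fst q) z)) (dist (fst q) y)"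
    have L: "0 < dist y z" "dist y z < pi" using False r yt by (auto intro: le_less_trans)
    have sinL: "sin (dist y z) > 0" using L by (rule sin_gt_zero)
    have "((\<lambda>q. dist (fst q) y) \<longlongrightarrow> dist y y) ?F" by (intro tendsto_intros fst)
    then have dy: "((\<lambda>q. dist (fst q) y) \<longlongrightarrow> 0) ?F" by simp
    have "(?\<theta> \<longlongrightarrow> side_cos (dist y z) ?s (dist y z) ?s 0) ?F"
      using sinL by (intro tendsto_side_cos L' dy tendsto_min tendsto_mult tendsto_const snd) auto
    then have lim: "(?\<theta> \<longlongrightarrow> 1) ?F" using side_cos_refl sinL by simp
    have "\<forall>\<^sub>F q in ?F. 0 < dist (fst q) z" using order_tendstoD(1)[OF L' L(1)] .
    \<comment> \<open>The other two sides have length at most \<open>r\<close>, so this bound keeps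
      the perimeter below \<open>2 * pi\<close> and also provides a geodesic for the third
      side.\<close>
    moreover have "\<forall>\<^sub>F q in ?F. dist (fst q) y < min pi (2 * pi - 2 * r)"
      by (rule order_tendstoD(2)[OF dy]) (use r(2) in simp)
    ultimately have ev: "\<forall>\<^sub>F q in ?F. ?\<theta> q \<in> {-1..1} \<and> dist (\<gamma> y ?s) (?\<phi> q) \<le> arccos (?\<theta> q)"
      using inS
    proof eventually_elim
      case (elim q)
      then have q: "fst q \<in> X" "dist (fst q) z < pi" using r(1)[of "fst q"] r(2) by auto
      have "dist y z + dist (fst q) z + dist (fst q) y < 2 * pi" "dist (fst q) y < pi"
        using elim(2) r(1)[OF q(1)] r(1)[OF yt(2)] by auto
      moreover have "?s \<in> {0..dist y z}" using par[OF p] yt by simp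
      ultimately show ?case
        using CAT1_sides[OF X \<gamma>[OF yt(2)] \<gamma>[OF q(1)] L elim(1) q(2) _ _ _ par[OF elim(3)]] by blast
    qed
    have "((\<lambda>q. arccos (?\<theta> q)) \<longlongrightarrow> arccos 1) ?F"
      by (rule continuous_on_tendsto_compose[OF continuous_on_arccos' lim]) (use ev in \<open>auto elim: eventually_mono\<close>)
    then have "((\<lambda>q. arccos (?\<theta> q)) \<longlongrightarrow> 0) ?F" by simp
    moreover have "\<forall>\<^sub>F q in ?F. norm (dist (?\<phi> q) (?\<phi> p)) \<le> arccos (?\<theta> q)"
      using ev by (rule eventually_mono) (simp add: yt dist_commute)
    ultimately show ?thesis by (rule Lim_null_comparison[rotated])
  qed
  then show "(?\<phi> \<longlongrightarrow> ?\<phi> p) ?F" using tendsto_dist_iff by blast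
qed

text \<open>Choose \<open>z\<close> at distance more than \<open>r - \<delta> / 2\<close> from
  \<open>x\<close>. After moving by \<open>\<delta>\<close> towards \<open>z\<close>, every point is
  within \<open>r - \<delta>\<close> of \<open>z\<close>, hence at least \<open>\<delta> / 2\<close>
  away from \<open>x\<close>.\<close>

lemma CAT1_points_removable:
  fixes X :: "'a::metric_space set"
  assumes X: "CAT1 X" and r: "0 < r" "r < pi" "\<And>x y. x \<in> X \<Longrightarrow> y \<in> X \<Longrightarrow> dist x y \<le> r"
    and far: "\<And>x e. x \<in> X \<Longrightarrow> 0 < e \<Longrightarrow> \<exists>z\<in>X. r - e < dist x z"
  shows "points_removable X"
  unfolding points_removable_def
proof (intro ballI allI impI)
  fix x and \<eta> :: real assume x: "x \<in> X" and "\<eta> > 0"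
  \<comment> \<open>The bound by \<open>r\<close> covers points that reach \<open>z\<close> early:
    their final distance \<open>0\<close> to \<open>z\<close> is still at most
    \<open>r - \<delta>\<close>.\<close>
  define \<delta> where "\<delta> = min \<eta> r"
  have \<delta>: "0 < \<delta>" "\<delta> \<le> \<eta>" "\<delta> \<le> r" using \<open>\<eta> > 0\<close> r by (auto simp: \<delta>_def)
  obtain z where z: "z \<in> X" "r - \<delta> / 2 < dist x z" using far[OF x, of "\<delta> / 2"] \<delta> by auto
  have "\<exists>g. geodesic X dist y z g" if "y \<in> X" for y
    using X that z r(2) r(3)[OF that z(1)] unfolding CAT1_def by (meson le_less_trans)
  then obtain \<gamma> where \<gamma>: "\<And>y. y \<in> X \<Longrightarrow> geodesic X dist y z (\<gamma> y)" by metis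
  define \<phi> where "\<phi> = (\<lambda>p. \<gamma> (fst p) (min (\<delta> * snd p) (dist (fst p) z)))"
  have par: "min (\<delta> * t) (dist y z) \<in> {0..dist y z}" if "t \<in> {0..1}" for y t
    using that \<delta> by (auto simp: min_def)
  have d0: "dist y (\<phi> (y, t)) = min (\<delta> * t) (dist y z)" if "y \<in> X" "t \<in> {0..1}" for y t
  proof -
    have "dist (\<gamma> y 0) (\<phi> (y, t)) = \<bar>0 - min (\<delta> * t) (dist y z)\<bar>"
      using geodesic_dist[OF \<gamma>[OF that(1)] _ par[OF that(2)], of 0] by (simp add: \<phi>_def)
    moreover have "\<gamma> y 0 = y" using \<gamma>[OF that(1)] by (simp add: geodesic_def)
    ultimately show ?thesis using par[OF that(2), of y] by simp
  qed
  have d1: "dist (\<phi> (y, t)) z = dist y z - min (\<delta> * t) (dist y z)" if "y \<in> X" "t \<in> {0..1}" for y t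
  proof -
    have "dist (\<phi> (y, t)) (\<gamma> y (dist y z)) = \<bar>min (\<delta> * t) (dist y z) - dist y z\<bar>"
      using geodesic_dist[OF \<gamma>[OF that(1)] par[OF that(2)], of "dist y z"] by (simp add: \<phi>_def)
    moreover have "\<gamma> y (dist y z) = z" using \<gamma>[OF that(1)] by (simp add: geodesic_def)
    ultimately show ?thesis by simp
  qed
  have "continuous_on (X \<times> {0..1}) \<phi>"
    unfolding \<phi>_def using r z \<delta> by (intro CAT1_flow_continuous[OF X z(1) _ r(2) \<gamma>]) auto
  moreover have "\<phi> ` (X \<times> {0..1}) \<subseteq> X"
    using \<gamma> par unfolding \<phi>_def geodesic_def by (auto simp: image_subset_iff)
  moreover have "\<phi> (y, 0) = y" if "y \<in> X" for y
    using d0[OF that, of 0] by simp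
  moreover have "\<delta> / 2 \<le> dist x (\<phi> (y, 1))" if "y \<in> X" for y
  proof -
    have "dist (\<phi> (y, 1)) z \<le> r - \<delta>" using d1[OF that, of 1] r(3)[OF that z(1)] \<delta> by (auto simp: min_def)
    then show ?thesis using dist_triangle[of x z "\<phi> (y, 1)"] z(2) by simp
  qed
  moreover have "dist y (\<phi> (y, t)) \<le> \<eta>" if "y \<in> X" "t \<in> {0..1}" for y t
  proof -
    have "\<delta> * t \<le> \<delta>" using that \<delta> by (simp add: mult_left_le)
    then have "min (\<delta> * t) (dist y z) \<le> \<eta>" using \<delta>(2) by linarith
    then show ?thesis using d0[OF that] by simp
  qed
  ultimately show "\<exists>\<rho>>0. \<exists>\<phi>. continuous_on (X \<times> {0..1::real}) \<phi> \<and> \<phi> ` (X \<times> {0..1}) \<subseteq> X \<and>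
      (\<forall>y\<in>X. \<phi> (y, 0) = y \<and> \<rho> \<le> dist x (\<phi> (y, 1)) \<and> (\<forall>t\<in>{0..1}. dist y (\<phi> (y, t)) \<le> \<eta>))"
    using \<delta>(1) by (intro exI[of _ "\<delta> / 2"]) auto
qed

subsection \<open>Dimension, radius and diameter\<close>

lemma refinable_to_ply_mono:
  assumes "refinable_to_ply T n" "n \<le> N"
  shows "refinable_to_ply T N"
  unfolding refinable_to_ply_def
proof (intro allI impI)
  fix \<U> assume "(\<forall>U\<in>\<U>. openin T U) \<and> \<Union>\<U> = topspace T"
  then obtain \<V> where "(\<forall>V\<in>\<V>. openin T V) \<and> \<Union>\<V> = topspace T \<and> (\<forall>V\<in>\<V>. \<exists>U\<in>\<U>. V \<subseteq> U) \<and>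
      (\<forall>x\<in>topspace T. finite {V \<in> \<V>. x \<in> V} \<and> card {V \<in> \<V>. x \<in> V} \<le> n)"
    by (rule assms(1)[unfolded refinable_to_ply_def, THEN spec, THEN mp, THEN exE])
  then show "\<exists>\<V>. (\<forall>V\<in>\<V>. openin T V) \<and> \<Union>\<V> = topspace T \<and> (\<forall>V\<in>\<V>. \<exists>U\<in>\<U>. V \<subseteq> U) \<and>
      (\<forall>x\<in>topspace T. finite {V \<in> \<V>. x \<in> V} \<and> card {V \<in> \<V>. x \<in> V} \<le> N)"
    using assms(2) by (intro exI[of _ \<V>]) (simp add: le_trans[OF _ assms(2)])
qed

text \<open>A natural number above the supremum bounds the ply for all compact subsets at once, by
  monotonicity in the ply.\<close>

lemma geometric_dim_finite:
  assumes "geometric_dim X < \<infinity>"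
  obtains n where "\<And>K. compact K \<Longrightarrow> K \<subseteq> X \<Longrightarrow> refinable_to_ply (top_of_set K) (Suc n)"
proof -
  obtain N :: nat where N: "geometric_dim X < ereal (real N)"
    using assms less_PInf_Ex_of_nat by auto
  have "refinable_to_ply (top_of_set K) (Suc N)" if "compact K" "K \<subseteq> X" for K
  proof -
    have "covering_dim (top_of_set K) \<le> geometric_dim X"
      unfolding geometric_dim_def using that by (intro SUP_upper) auto
    then have "covering_dim (top_of_set K) < ereal (real N)" using N by (rule le_less_trans)
    then obtain k where k: "refinable_to_ply (top_of_set K) k" "real k - 1 < real N"
      unfolding covering_dim_def INF_less_iff by auto
    then have "k \<le> Suc N" by linarith
    then show ?thesis by (rule refinable_to_ply_mono[OF k(1)])
  qed
  then show thesis using that by blast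
qed

text \<open>All distances are bounded by the diameter, hence by the radius \<open>r\<close>, while
  the supremum of distances from any point is at least \<open>r\<close>.\<close>

lemma diam_le_rad:
  assumes "\<not> diam X > rad X" "rad X < \<infinity>"
  obtains r where "rad X = ereal r" "\<And>x y. x \<in> X \<Longrightarrow> y \<in> X \<Longrightarrow> dist x y \<le> r"
    "\<And>x e. x \<in> X \<Longrightarrow> 0 < e \<Longrightarrow> \<exists>z\<in>X. r - e < dist x z"
proof -
  have le: "ereal (dist x y) \<le> rad X" if "x \<in> X" "y \<in> X" for x y
  proof -
    have "ereal (dist x y) \<le> rad_at X x" unfolding rad_at_def using that by (intro SUP_upper)
    also have "\<dots> \<le> diam X" unfolding diam_def using that by (intro SUP_upper)
    also have "\<dots> \<le> rad X" using assms by simp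
    finally show ?thesis .
  qed
  obtain x0 where "x0 \<in> X" using assms(2) by (cases "X = {}") (auto simp: rad_def top_ereal_def)
  then have "0 \<le> rad X" using le[of x0 x0] by (simp add: zero_ereal_def)
  then obtain r where r: "rad X = ereal r" using assms(2) by (cases "rad X") auto
  have "\<exists>z\<in>X. r - e < dist x z" if "x \<in> X" "0 < e" for x e
  proof -
    have "ereal (r - e) < rad X" using that by (simp add: r)
    also have "rad X \<le> rad_at X x" unfolding rad_def using that by (intro INF_lower)
    finally show ?thesis unfolding rad_at_def less_SUP_iff by simp
  qed
  then show thesis using that r le by simp
qed

theorem proposition1p2:
  fixes X :: "'a::metric_space set"
  assumes "CAT1 X"
    and "geometric_dim X < \<infinity>"
    and "\<not> is_singleton X"
    and "rad X < ereal pi"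
  shows "diam X > rad X"
proof (rule ccontr)
  assume not_less: "\<not> diam X > rad X"
  have "rad X < \<infinity>" by (rule less_trans[OF assms(4)]) simp
  then obtain r where r: "rad X = ereal r" "\<And>x y. x \<in> X \<Longrightarrow> y \<in> X \<Longrightarrow> dist x y \<le> r"
    "\<And>x e. x \<in> X \<Longrightarrow> 0 < e \<Longrightarrow> \<exists>z\<in>X. r - e < dist x z"
    using diam_le_rad[OF not_less] by blast
  \<comment> \<open>The empty set has radius \<open>\<infinity>\<close>, an infimum over
    nothing.\<close>
  have "X \<noteq> {}" using assms(4) by (auto simp: rad_def top_ereal_def)
  then obtain p q where pq: "p \<in> X" "q \<in> X" "p \<noteq> q"
    using assms(3) by (metis equals0I is_singletonI')
  have "0 < dist p q" using pq by simp
  then have "0 < r" using r(2)[OF pq(1,2)] by linarith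
  moreover have "r < pi" using assms(4) r(1) by simp
  ultimately have r0: "0 < r" "r < pi" by auto
  obtain \<gamma> where \<gamma>: "geodesic X dist p q \<gamma>"
    using assms(1) pq r(2)[OF pq(1,2)] r0 unfolding CAT1_def by (meson le_less_trans)
  obtain n where n: "\<And>K. compact K \<Longrightarrow> K \<subseteq> X \<Longrightarrow> refinable_to_ply (top_of_set K) (Suc n)"
    using geometric_dim_finite[OF assms(2)] by metis
  have rng: "dist p q * t \<in> {0..dist p q}" if "t \<in> {0..1}" for t
    using that by (auto simp: mult_left_le)
  have "continuous_on {0..dist p q} \<gamma>"
    unfolding continuous_on_iff
  proof (intro ballI allI impI)
    fix s and e :: real assume "s \<in> {0..dist p q}" "0 < e"
    then show "\<exists>d>0. \<forall>t\<in>{0..dist p q}. dist t s < d \<longrightarrow> dist (\<gamma> t) (\<gamma> s) < e"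
      using geodesic_dist[OF \<gamma>] by (intro exI[of _ e]) (auto simp: dist_real_def)
  qed
  \<comment> \<open>The geodesic from \<open>p\<close> to \<open>q\<close>, rescaled to the unit
    interval, is the path along which the extension property fails.\<close>
  then have "continuous_on {0..1} (\<lambda>t. \<gamma> (dist p q * t))"
    by (rule continuous_on_compose2) (use rng in \<open>auto intro!: continuous_intros\<close>)
  moreover have "(\<lambda>t. \<gamma> (dist p q * t)) ` {0..1} \<subseteq> X"
    using \<gamma> rng unfolding geodesic_def by (auto simp: image_subset_iff)
  moreover have "\<gamma> (dist p q * 0) \<noteq> \<gamma> (dist p q * 1)" using \<gamma> pq by (simp add: geodesic_def)
  ultimately obtain K where "compact K" "K \<subseteq> X" "\<not> refinable_to_ply (top_of_set K) (Suc n)"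
    using points_removable_infinite_dimensional[OF CAT1_points_removable[OF assms(1) r0 r(2,3)],
        of "\<lambda>t. \<gamma> (dist p q * t)" n] by metis
  then show False using n by blast
qed

end
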